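(* Let $F(x,y)=\frac13x^3+\frac12x^2+(x+y)^2y^2+\frac14y^4$, and consider the foliation associated with the planar gradient system of $F$, namely $$\frac{dy}{dx}=\frac{\partial F/\partial y}{\partial F/\partial x}=\frac{2(x+y)y^2+2(x+y)^2y+y^3}{x^2+x+2(x+y)y^2}.$$ The line $\Gamma=\{y=0\}$ is an invariant curve of this equation. The linearized second variational equation $LVE_2$ of this equation along $\Gamma$ is $$\chi_1'=2\,\frac{2x}{x+1}\,\chi_1,\qquad \chi_2'=\frac{2x}{x+1}\,\chi_2+\frac{12}{x+1}\,\chi_1,\qquad {}'=\frac{d}{dx}.$$ Let $G_2$ be the differential Galois group of $LVE_2$ over the differential field $(\mathbb{C}(x),d/dx)$. Then the identity component $G_2^0$ of the algebraic group $G_2$ is not commutative.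
   Context: For a scalar equation $\frac{dy}{dx}=f(x,y)$ with $f$ rational and with particular solution $y\equiv 0$ (that is, $f(x,0)=0$), put $\beta_k(x)=\frac{\partial^k f}{\partial y^k}(x,0)$. Writing $\varphi_1,\varphi_2$ for the first and second derivatives, at the solution $y\equiv0$, of the solution with respect to its initial condition, the variational equations up to order two are $\varphi_1'=\beta_1\varphi_1$ and $\varphi_2'=\beta_1\varphi_2+\beta_2\varphi_1^2$. The linearized second variational equation $LVE_2$ along $\Gamma=\{y=0\}$ is the linear system obtained by setting $\chi_1=\varphi_1^2$, $\chi_2=\varphi_2$: $$\chi_1'=2\beta_1\chi_1,\qquad \chi_2'=\beta_1\chi_2+\beta_2\chi_1.$$ The differential Galois group of a linear differential system over $\mathbb{C}(x)$ is the group of differential $\mathbb{C}(x)$-automorphisms of its Picard–Vessiot extension. It is regarded as a linear algebraic group over $\mathbb{C}$ via its action on a fundamental matrix of solutions, and its identity component is taken in the Zariski topology. *)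

theory Defs
  imports
    "HOL-Analysis.Analysis"
    "HOL-Computational_Algebra.Polynomial_Factorial"
begin

section \<open>Rational functions and their derivatives\<close>

text \<open>
  The field \<open>\<complex>(x)\<close> is the type \<open>complex poly fract\<close>. A polynomial in \<open>\<complex>[x,y]\<close> is an element of
  \<open>complex poly poly\<close>, the outer variable being \<open>y\<close> and the inner one \<open>x\<close>; accordingly
  \<open>\<complex>(x,y)\<close> is \<open>complex poly poly fract\<close>.
\<close>

type_synonym ratfun = "complex poly fract"
type_synonym ratfun2 = "complex poly poly fract"

definition cst :: "complex \<Rightarrow> ratfun" where
  "cst c = to_fract [:c:]"

definition xK :: ratfun where
  "xK = to_fract [:0, 1:]"

definition cst2 :: "complex \<Rightarrow> complex poly poly" where
  "cst2 c = [:[:c:]:]"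

definition X :: "complex poly poly" where
  "X = [:[:0, 1:]:]"

definition Y :: "complex poly poly" where
  "Y = [:0, 1:]"

text \<open>
  The derivation \<open>d/dt\<close> of the fraction field of \<open>R[t]\<close>, given by the quotient rule. For
  \<open>R = \<complex>\<close> it is \<open>d/dx\<close> on \<open>\<complex>(x)\<close>; for \<open>R = \<complex>[x]\<close> it is \<open>\<partial>/\<partial>y\<close> on \<open>\<complex>(x,y)\<close>.
\<close>

definition fract_pderiv :: "'a::idom poly fract \<Rightarrow> 'a poly fract" where
  "fract_pderiv r = (THE s. \<exists>p q. q \<noteq> 0 \<and> r = to_fract p / to_fract q \<and>
     s = to_fract (pderiv p * q - p * pderiv q) / to_fract (q * q))"

lemma fract_pderiv_divide:
  fixes p q :: "'a::idom poly"
  assumes "q \<noteq> 0"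
  shows "fract_pderiv (to_fract p / to_fract q)
       = to_fract (pderiv p * q - p * pderiv q) / to_fract (q * q)"
  unfolding fract_pderiv_def
proof (rule the_equality)
  fix s
  assume "\<exists>a b. b \<noteq> 0 \<and> to_fract p / to_fract q = to_fract a / to_fract b \<and>
     s = to_fract (pderiv a * b - a * pderiv b) / to_fract (b * b)"
  then obtain a b where nz: "b \<noteq> 0" and ab: "to_fract p / to_fract q = to_fract a / to_fract b"
    and s: "s = to_fract (pderiv a * b - a * pderiv b) / to_fract (b * b)"
    by blast
  have "to_fract (a * q) = to_fract (p * b)"
    using ab nz assms by (simp add: field_simps)
  then have eq: "a * q = p * b"
    by (simp only: to_fract_eq_iff)
  have deq: "a * pderiv q + q * pderiv a = p * pderiv b + b * pderiv p"
    using arg_cong[OF eq, of pderiv] by (simp add: pderiv_mult)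
  have "(pderiv a * b - a * pderiv b) * (q * q) - (pderiv p * q - p * pderiv q) * (b * b)
      = b * q * ((a * pderiv q + q * pderiv a) - (p * pderiv b + b * pderiv p))
        - (a * q - p * b) * (b * pderiv q + q * pderiv b)"
    by (simp add: algebra_simps)
  also have "\<dots> = 0"
    by (simp add: eq deq)
  finally have "(pderiv a * b - a * pderiv b) * (q * q) = (pderiv p * q - p * pderiv q) * (b * b)"
    by simp
  then have "to_fract (pderiv a * b - a * pderiv b) * to_fract (q * q)
      = to_fract (pderiv p * q - p * pderiv q) * to_fract (b * b)"
    by (simp only: to_fract_mult[symmetric])
  moreover have "to_fract (q * q) \<noteq> 0" "to_fract (b * b) \<noteq> 0"
    using nz assms by simp_all
  ultimately show "s = to_fract (pderiv p * q - p * pderiv q) / to_fract (q * q)"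
    unfolding s by (simp add: frac_eq_eq del: to_fract_mult)
qed (use assms in blast)

section \<open>Scalar equations \<open>dy/dx = f(x,y)\<close> and the linearized second variational equation\<close>

text \<open>
  \<open>has_value_along s r v\<close>: the rational function \<open>r(x,y)\<close> is regular along the curve
  \<open>y = s(x)\<close> (not identically a pole) and \<open>r(x,s(x)) = v(x)\<close>.
\<close>

definition has_value_along :: "ratfun \<Rightarrow> ratfun2 \<Rightarrow> ratfun \<Rightarrow> bool" where
  "has_value_along s r v \<longleftrightarrow>
    (\<exists>p q. poly (map_poly to_fract q) s \<noteq> 0 \<and> r = to_fract p / to_fract q \<and>
           v = poly (map_poly to_fract p) s / poly (map_poly to_fract q) s)"

lemma map_poly_to_fract_mult:
  "map_poly to_fract (p * q) = map_poly to_fract p * map_poly to_fract (q :: 'a::idom poly)"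
  by (rule poly_eqI) (simp add: coeff_map_poly coeff_mult to_fract_sum)

lemma has_value_along_unique:
  assumes "has_value_along s r v" "has_value_along s r w"
  shows "v = w"
proof -
  let ?e = "\<lambda>p. poly (map_poly to_fract p) s"
  obtain p q p' q' where 1: "?e q \<noteq> 0" "r = to_fract p / to_fract q" "v = ?e p / ?e q"
    and 2: "?e q' \<noteq> 0" "r = to_fract p' / to_fract q'" "w = ?e p' / ?e q'"
    using assms unfolding has_value_along_def by blast
  have "q \<noteq> 0" "q' \<noteq> 0"
    using 1(1) 2(1) by auto
  then have "to_fract (p * q') = to_fract (p' * q)"
    using 1(2) 2(2) by (simp add: field_simps)
  then have "p * q' = p' * q"
    by (simp only: to_fract_eq_iff)
  then have "?e (p * q') = ?e (p' * q)"
    by simp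
  then have "?e p * ?e q' = ?e p' * ?e q"
    by (simp only: map_poly_to_fract_mult poly_mult)
  then show "v = w"
    unfolding 1(3) 2(3) using 1(1) 2(1) by (simp add: frac_eq_eq)
qed

definition value_along :: "ratfun \<Rightarrow> ratfun2 \<Rightarrow> ratfun" where
  "value_along s r = (THE v. has_value_along s r v)"

lemma value_along_eqI: "has_value_along s r v \<Longrightarrow> value_along s r = v"
  unfolding value_along_def by (blast intro: has_value_along_unique)

text \<open>The curve \<open>y = s(x)\<close> is an invariant curve of \<open>dy/dx = f(x,y)\<close>, i.e. \<open>s' = f(x,s)\<close>.\<close>

definition is_particular_solution :: "ratfun2 \<Rightarrow> ratfun \<Rightarrow> bool" where
  "is_particular_solution f s \<longleftrightarrow> has_value_along s f (fract_pderiv s)"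

definition \<beta> :: "ratfun2 \<Rightarrow> nat \<Rightarrow> ratfun" where
  "\<beta> f k = value_along 0 ((fract_pderiv ^^ k) f)"

text \<open>
  The coefficient matrix of \<open>LVE\<^sub>2\<close> along \<open>y = 0\<close>, for the column vector \<open>(\<chi>\<^sub>1, \<chi>\<^sub>2)\<close>.
\<close>

definition LVE2 :: "ratfun2 \<Rightarrow> ratfun^2^2" where
  "LVE2 f = vector [vector [2 * \<beta> f 1, 0],
                    vector [\<beta> f 2,     \<beta> f 1]]"

text \<open>\<open>dy/dx = (\<partial>F/\<partial>y) / (\<partial>F/\<partial>x)\<close>: since \<open>y\<close> is the outer variable, \<open>pderiv\<close> is \<open>\<partial>/\<partial>y\<close>.\<close>

definition gradient_slope :: "complex poly poly \<Rightarrow> ratfun2" where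
  "gradient_slope F = to_fract (pderiv F) / to_fract (map_poly pderiv F)"

section \<open>Picard--Vessiot extensions and differential Galois groups over \<open>\<complex>(x)\<close>\<close>

definition derivation :: "('l::comm_ring_1 \<Rightarrow> 'l) \<Rightarrow> bool" where
  "derivation d \<longleftrightarrow> (\<forall>a b. d (a + b) = d a + d b) \<and> (\<forall>a b. d (a * b) = d a * b + a * d b)"

definition ring_homomorphism :: "('k::comm_ring_1 \<Rightarrow> 'l::comm_ring_1) \<Rightarrow> bool" where
  "ring_homomorphism h \<longleftrightarrow>
    h 1 = 1 \<and> (\<forall>a b. h (a + b) = h a + h b) \<and> (\<forall>a b. h (a * b) = h a * h b)"

definition is_subfield :: "('l::field) set \<Rightarrow> bool" where
  "is_subfield S \<longleftrightarrow> 1 \<in> S \<and> (\<forall>a\<in>S. \<forall>b\<in>S. a - b \<in> S \<and> a * b \<in> S) \<and> (\<forall>a\<in>S. inverse a \<in> S)"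

text \<open>
  The type \<open>'l\<close> with derivation \<open>d\<close> and structure map \<open>\<iota>\<close> is a Picard--Vessiot extension of
  \<open>\<complex>(x)\<close> for \<open>Y' = A Y\<close>, and \<open>\<Phi>\<close> is a fundamental matrix of solutions in it. The last
  conjunct says that there are no constants besides those of \<open>\<complex>(x)\<close>.
\<close>

definition picard_vessiot ::
  "ratfun^'n^'n \<Rightarrow> (ratfun \<Rightarrow> 'l::field) \<Rightarrow> ('l \<Rightarrow> 'l) \<Rightarrow> 'l^'n^'n \<Rightarrow> bool" where
  "picard_vessiot A \<iota> d \<Phi> \<longleftrightarrow>
     ring_homomorphism \<iota> \<and> derivation d \<and> (\<forall>a. d (\<iota> a) = \<iota> (fract_pderiv a)) \<and>
     invertible \<Phi> \<and> map_matrix d \<Phi> = map_matrix \<iota> A ** \<Phi> \<and>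
     (\<forall>S. is_subfield S \<and> range \<iota> \<subseteq> S \<and> (\<forall>i j. \<Phi> $ i $ j \<in> S) \<longrightarrow> S = UNIV) \<and>
     {a. d a = 0} = range (\<lambda>c. \<iota> (cst c))"

definition diff_automorphisms :: "(ratfun \<Rightarrow> 'l::field) \<Rightarrow> ('l \<Rightarrow> 'l) \<Rightarrow> ('l \<Rightarrow> 'l) set" where
  "diff_automorphisms \<iota> d =
     {\<sigma>. bij \<sigma> \<and> ring_homomorphism \<sigma> \<and> (\<forall>a. \<sigma> (\<iota> a) = \<iota> a) \<and> (\<forall>a. \<sigma> (d a) = d (\<sigma> a))}"

text \<open>
  The differential Galois group as a group of complex matrices: \<open>M\<close> represents \<open>\<sigma>\<close> if
  \<open>\<sigma>(\<Phi>) = \<Phi> M\<close>.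
\<close>

definition diff_galois_group ::
  "(ratfun \<Rightarrow> 'l::field) \<Rightarrow> ('l \<Rightarrow> 'l) \<Rightarrow> 'l^'n^'n \<Rightarrow> (complex^'n^'n) set" where
  "diff_galois_group \<iota> d \<Phi> =
     {M. \<exists>\<sigma> \<in> diff_automorphisms \<iota> d.
           map_matrix \<sigma> \<Phi> = \<Phi> ** map_matrix (\<lambda>c. \<iota> (cst c)) M}"

section \<open>The Zariski topology on matrices\<close>

inductive matrix_polynomial :: "(complex^'n^'m \<Rightarrow> complex) \<Rightarrow> bool" where
  entry: "matrix_polynomial (\<lambda>M. M $ i $ j)"
| const: "matrix_polynomial (\<lambda>M. c)"
| add: "\<lbrakk>matrix_polynomial p; matrix_polynomial q\<rbrakk> \<Longrightarrow> matrix_polynomial (\<lambda>M. p M + q M)"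
| mult: "\<lbrakk>matrix_polynomial p; matrix_polynomial q\<rbrakk> \<Longrightarrow> matrix_polynomial (\<lambda>M. p M * q M)"

definition zariski_closed :: "(complex^'n^'m) set \<Rightarrow> bool" where
  "zariski_closed V \<longleftrightarrow>
     (\<exists>P. (\<forall>p\<in>P. matrix_polynomial p) \<and> V = {M. \<forall>p\<in>P. p M = 0})"

definition zariski_topology :: "(complex^'n^'m) topology" where
  "zariski_topology = topology (\<lambda>U. zariski_closed (- U))"

lemma istopology_zariski: "istopology (\<lambda>U :: (complex^'n^'m) set. zariski_closed (- U))"
  unfolding istopology_def
proof (intro conjI allI impI)
  fix S T :: "(complex^'n^'m) set"
  assume "zariski_closed (- S)" "zariski_closed (- T)"
  then obtain P Q where P: "\<forall>p\<in>P. matrix_polynomial p" "- S = {M. \<forall>p\<in>P. p M = 0}"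
    and Q: "\<forall>p\<in>Q. matrix_polynomial p" "- T = {M. \<forall>p\<in>Q. p M = 0}"
    unfolding zariski_closed_def by blast
  let ?R = "{\<lambda>M. p M * q M |p q. p \<in> P \<and> q \<in> Q}"
  have "- (S \<inter> T) = - S \<union> - T"
    by blast
  also have "\<dots> = {M. \<forall>r\<in>?R. r M = 0}"
    unfolding P(2) Q(2)
  proof (intro equalityI subsetI)
    fix M
    assume "M \<in> {M. \<forall>r\<in>?R. r M = 0}"
    then have M: "\<forall>r\<in>?R. r M = 0"
      by (rule CollectD)
    show "M \<in> {M. \<forall>p\<in>P. p M = 0} \<union> {M. \<forall>q\<in>Q. q M = 0}"
    proof (rule ccontr)
      assume "M \<notin> {M. \<forall>p\<in>P. p M = 0} \<union> {M. \<forall>q\<in>Q. q M = 0}"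
      then obtain p q where pq: "p \<in> P" "q \<in> Q" "p M \<noteq> 0" "q M \<noteq> 0"
        by blast
      then have "(\<lambda>M. p M * q M) \<in> ?R"
        by (intro CollectI exI[of _ p] exI[of _ q]) simp
      from bspec[OF M this] have "p M * q M = 0" .
      then show False
        using pq by simp
    qed
  qed auto
  finally show "zariski_closed (- (S \<inter> T))"
    unfolding zariski_closed_def using P(1) Q(1)
    by (intro exI[of _ ?R]) (auto intro: matrix_polynomial.mult)
next
  fix K :: "(complex^'n^'m) set set"
  assume "\<forall>U\<in>K. zariski_closed (- U)"
  then have "\<forall>U\<in>K. \<exists>P. (\<forall>p\<in>P. matrix_polynomial p) \<and> - U = {M. \<forall>p\<in>P. p M = 0}"
    unfolding zariski_closed_def .
  from bchoice[OF this] obtain P where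
    P: "\<forall>U\<in>K. (\<forall>p\<in>P U. matrix_polynomial p) \<and> - U = {M. \<forall>p\<in>P U. p M = 0}"
    by (rule exE)
  have "- (\<Union>K) = (\<Inter>U\<in>K. - U)"
    by blast
  also have "\<dots> = (\<Inter>U\<in>K. {M. \<forall>p\<in>P U. p M = 0})"
    using P by simp
  also have "\<dots> = {M. \<forall>p\<in>(\<Union>U\<in>K. P U). p M = 0}"
    by auto
  finally show "zariski_closed (- (\<Union>K))"
    unfolding zariski_closed_def using P
    by (intro exI[of _ "\<Union>U\<in>K. P U"]) simp
qed

lemma openin_zariski_topology: "openin zariski_topology U \<longleftrightarrow> zariski_closed (- U)"
  unfolding zariski_topology_def
  by (rule fun_cong[OF topology_inverse'[OF istopology_zariski]])

text \<open>
  On a set of invertible matrices, the subspace topology from the affine space of all matrices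
  agrees with the one from \<open>GL\<^sub>n\<close>.
\<close>

definition identity_component :: "(complex^'n^'n) set \<Rightarrow> (complex^'n^'n) set" where
  "identity_component G = connected_component_of_set (subtopology zariski_topology G) (mat 1)"

definition commutative :: "(complex^'n^'n) set \<Rightarrow> bool" where
  "commutative G \<longleftrightarrow> (\<forall>M\<in>G. \<forall>N\<in>G. M ** N = N ** M)"

end

theory Submission
  imports Defs "HOL-Computational_Algebra.Field_as_Ring"
begin

text \<open>
  Write \<open>b = 2x/(x+1)\<close> and \<open>g = 12/(x+1)\<close>. Every Picard--Vessiot extension is \<open>\<complex>(x)(e,v)\<close> with
  \<open>e' = b e\<close> and \<open>v' = g e\<close>, a fundamental matrix being \<open>((e\<^sup>2, 0), (e v, e))\<close>. A polynomial
  relation between \<open>e\<close> and \<open>v\<close>, minimal first in its \<open>v\<close>-degree and then in the \<open>e\<close>-degree of the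
  leading coefficient, is reproduced by the derivation up to a factor; comparing coefficients
  yields a nonzero rational solution of \<open>a' = k b a\<close> or a rational solution of \<open>a' + b a = k g\<close>
  with \<open>k > 0\<close>, and neither exists. Hence \<open>e\<close> and \<open>v\<close> are algebraically independent, and every
  substitution \<open>e \<mapsto> \<alpha> e\<close>, \<open>v \<mapsto> \<alpha> v + \<gamma>\<close> with \<open>\<alpha> \<noteq> 0\<close> is a differential automorphism. The
  matrices of these automorphisms lie on polynomial curves through the identity, which are
  connected, and they do not commute.
\<close>

section \<open>Homomorphisms and automorphisms of fraction fields\<close>

context
  fixes h :: "'a::comm_ring_1 \<Rightarrow> 'b::comm_ring_1"
  assumes h: "ring_homomorphism h"
begin

lemma ring_homomorphism_simps:
  "h 1 = 1" "h 0 = 0" "h (a + b) = h a + h b" "h (a * b) = h a * h b" "h (- a) = - h a" "h (a - b) = h a - h b"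
proof -
  show 1: "h 1 = 1" "h (a + b) = h a + h b" "h (a * b) = h a * h b" for a b
    using h unfolding ring_homomorphism_def by auto
  show 0: "h 0 = 0" using 1(2)[of 0 0] by simp
  show 2: "h (- a) = - h a" for a using 1(2)[of a "- a"] 0 by (simp add: eq_neg_iff_add_eq_0 add.commute)
  show "h (a - b) = h a - h b" using 1(2)[of a "- b"] 2 by simp
qed

lemma ring_homomorphism_sum: "h (sum g A) = (\<Sum>x\<in>A. h (g x))"
  by (induction A rule: infinite_finite_induct) (simp_all add: ring_homomorphism_simps)

text \<open>Applied twice, this gives evaluation of polynomials in two indeterminates at a pair of
  field elements, which later presents the extension as a fraction field.\<close>

lemma ring_homomorphism_eval: "ring_homomorphism (\<lambda>p. poly (map_poly h p) x)"
proof -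
  have "map_poly h (p + q) = map_poly h p + map_poly h q" for p q
    by (rule poly_eqI) (simp add: coeff_map_poly ring_homomorphism_simps)
  moreover have "map_poly h (p * q) = map_poly h p * map_poly h q" for p q
    by (rule poly_eqI)
       (simp add: coeff_map_poly coeff_mult ring_homomorphism_simps ring_homomorphism_sum)
  moreover have "map_poly h 1 = 1"
    by (simp add: ring_homomorphism_simps)
  ultimately show ?thesis unfolding ring_homomorphism_def by simp
qed

end

lemma ring_homomorphism_inverse:
  fixes h :: "'a::field \<Rightarrow> 'b::field"
  assumes h: "ring_homomorphism h"
  shows "h (inverse a) = inverse (h a)" "h a = 0 \<longleftrightarrow> a = 0"
proof -
  have *: "h a * h (inverse a) = 1" if "a \<noteq> 0" for a
    using that ring_homomorphism_simps[OF h] by (metis right_inverse)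
  show "h a = 0 \<longleftrightarrow> a = 0"
    using *[of a] by (cases "a = 0") (auto simp: ring_homomorphism_simps[OF h])
  show "h (inverse a) = inverse (h a)"
    using *[of a] by (cases "a = 0") (auto simp: ring_homomorphism_simps[OF h] inverse_unique)
qed

text \<open>This subfield contains the image of \<open>h\<close>, so when that image generates the
  whole field, every element is a quotient \<open>h a / h b\<close>.\<close>

lemma fractions_form_subfield:
  fixes h :: "'r::idom \<Rightarrow> 'l::field"
  assumes h: "ring_homomorphism h" and inj: "\<And>r. h r = 0 \<Longrightarrow> r = 0"
  shows "is_subfield {h a / h b | a b. b \<noteq> 0}"
proof -
  note hs = ring_homomorphism_simps[OF h]
  let ?F = "{h a / h b | a b. b \<noteq> 0}"
  have "x - y \<in> ?F \<and> x * y \<in> ?F" if xy: "x \<in> ?F" "y \<in> ?F" for x y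
  proof -
    obtain a b where x: "x = h a / h b" "b \<noteq> 0" using xy(1) by blast
    obtain c d where y: "y = h c / h d" "d \<noteq> 0" using xy(2) by blast
    have "h b \<noteq> 0" "h d \<noteq> 0" using inj x(2) y(2) by auto
    then have "x - y = h (a * d - c * b) / h (b * d)" "x * y = h (a * c) / h (b * d)"
      unfolding x y hs by (simp_all add: field_simps)
    moreover have "b * d \<noteq> 0" using x y by simp
    ultimately show ?thesis by blast
  qed
  moreover have "inverse x \<in> ?F" if xF: "x \<in> ?F" for x
  proof -
    obtain a b where x: "x = h a / h b" "b \<noteq> 0" using xF by blast
    show ?thesis
    proof (cases "a = 0")
      case True
      then show ?thesis using x hs(2) by auto
    next
      case False
      then have "inverse x = h b / h a" using x by simp
      with False show ?thesis by blast
    qed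
  qed
  moreover have "1 \<in> ?F"
    by (auto simp: hs intro!: exI[of _ 1])
  ultimately show ?thesis unfolding is_subfield_def by blast
qed

text \<open>Both \<open>h\<close> and \<open>h'\<close> identify \<open>'l\<close> with the fraction field of \<open>'r\<close>.\<close>

lemma fraction_field_automorphism:
  fixes h h' :: "'r::idom \<Rightarrow> 'l::field"
  assumes h: "ring_homomorphism h" "\<And>r. h r = 0 \<Longrightarrow> r = 0"
    "\<And>S. is_subfield S \<Longrightarrow> range h \<subseteq> S \<Longrightarrow> S = UNIV"
    and h': "ring_homomorphism h'" "\<And>r. h' r = 0 \<Longrightarrow> r = 0"
    "\<And>S. is_subfield S \<Longrightarrow> range h' \<subseteq> S \<Longrightarrow> S = UNIV"
  shows "\<exists>\<sigma>. bij \<sigma> \<and> ring_homomorphism \<sigma> \<and> (\<forall>r. \<sigma> (h r) = h' r)"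
proof -
  have frac: "\<exists>a b. b \<noteq> 0 \<and> x = g a / g b"
    if g: "ring_homomorphism g" "\<And>r. g r = 0 \<Longrightarrow> r = 0"
      "\<And>S. is_subfield S \<Longrightarrow> range g \<subseteq> S \<Longrightarrow> S = UNIV" for g :: "'r \<Rightarrow> 'l" and x
  proof -
    have "g r = g r / g 1 \<and> (1 :: 'r) \<noteq> 0" for r
      using ring_homomorphism_simps(1)[OF g(1)] by simp
    then have "range g \<subseteq> {g a / g b | a b. b \<noteq> 0}" by blast
    then have "{g a / g b | a b. b \<noteq> 0} = UNIV"
      using g(3) fractions_form_subfield[OF g(1,2)] by blast
    then have "x \<in> {g a / g b | a b. b \<noteq> 0}" by simp
    then show ?thesis by blast
  qed
  have frac_h: "\<exists>a b. b \<noteq> 0 \<and> x = h a / h b" and frac_h': "\<exists>a b. b \<noteq> 0 \<and> x = h' a / h' b" for x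
    using frac[of h] frac[of h'] h h' by blast+
  obtain n e where ne: "\<And>x. e x \<noteq> 0" "\<And>x. x = h (n x) / h (e x)"
  proof -
    have "\<forall>x. \<exists>a b. b \<noteq> 0 \<and> x = h a / h b"
      using frac_h by (rule allI)
    then show ?thesis
      using that unfolding choice_iff by blast
  qed
  \<comment> \<open>The representation \<open>h (n x) / h (e x)\<close> is an arbitrary choice.
    Independence of it is \<open>eq\<close> below: cross-multiply and use that both maps have zero
    kernel.\<close>
  define \<sigma> where "\<sigma> x = h' (n x) / h' (e x)" for x
  note hs = ring_homomorphism_simps[OF h(1)] and hs' = ring_homomorphism_simps[OF h'(1)]
  have nz: "h b \<noteq> 0" "h' b \<noteq> 0" if "b \<noteq> 0" for b using h(2) h'(2) that by auto
  have eq: "h a / h b = h c / h d \<longleftrightarrow> h' a / h' b = h' c / h' d" if "b \<noteq> 0" "d \<noteq> 0" for a b c d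
  proof -
    have "h a / h b = h c / h d \<longleftrightarrow> h (a * d - c * b) = 0"
      unfolding hs using nz[OF that(1)] nz[OF that(2)] by (simp add: frac_eq_eq)
    also have "\<dots> \<longleftrightarrow> h' (a * d - c * b) = 0"
      using h(2) h'(2) hs(2) hs'(2) by metis
    also have "\<dots> \<longleftrightarrow> h' a / h' b = h' c / h' d"
      unfolding hs' using nz[OF that(1)] nz[OF that(2)] by (simp add: frac_eq_eq)
    finally show ?thesis .
  qed
  have \<sigma>: "\<sigma> (h a / h b) = h' a / h' b" if "b \<noteq> 0" for a b
    unfolding \<sigma>_def
    by (rule iffD1[OF eq[OF ne(1) that] ne(2)[of "h a / h b", symmetric]])
  have "\<sigma> (h r) = h' r" for r
    using \<sigma>[of 1 r] by (simp add: hs hs')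
  moreover have "ring_homomorphism \<sigma>"
    unfolding ring_homomorphism_def
  proof (intro conjI allI)
    show "\<sigma> 1 = 1" using \<sigma>[of 1 1] by (simp add: hs hs')
    fix x y
    obtain a b where x: "x = h a / h b" "b \<noteq> 0" using frac_h by blast
    obtain c d where y: "y = h c / h d" "d \<noteq> 0" using frac_h by blast
    have bd: "b * d \<noteq> 0" using x y by simp
    have "x + y = h (a * d + c * b) / h (b * d)" "x * y = h (a * c) / h (b * d)"
      unfolding x y hs using nz(1)[OF x(2)] nz(1)[OF y(2)] by (simp_all add: field_simps)
    then have "\<sigma> (x + y) = h' (a * d + c * b) / h' (b * d)" "\<sigma> (x * y) = h' (a * c) / h' (b * d)"
      using \<sigma>[OF bd] by simp_all
    then show "\<sigma> (x + y) = \<sigma> x + \<sigma> y" "\<sigma> (x * y) = \<sigma> x * \<sigma> y"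
      unfolding x y \<sigma>[OF x(2)] \<sigma>[OF y(2)] hs' using nz(2)[OF x(2)] nz(2)[OF y(2)]
      by (simp_all add: field_simps)
  qed
  moreover have "bij \<sigma>"
  proof (rule bijI)
    show "inj \<sigma>"
    proof (rule injI)
      fix x y assume "\<sigma> x = \<sigma> y"
      then show "x = y" unfolding \<sigma>_def
        using eq[OF ne(1)[of x] ne(1)[of y]] ne(2)[of x] ne(2)[of y] by metis
    qed
    show "surj \<sigma>"
      unfolding surj_def
    proof
      fix y
      obtain a b where "b \<noteq> 0" "y = h' a / h' b" using frac_h' by blast
      then have "y = \<sigma> (h a / h b)" using \<sigma> by simp
      then show "\<exists>x. y = \<sigma> x" by (rule exI)
    qed
  qed
  ultimately show ?thesis by blast
qed

section \<open>Algebraic independence\<close>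

lemma derivation_simps:
  assumes d: "derivation (d :: 'a::comm_ring_1 \<Rightarrow> 'a)"
  shows "d (a + b) = d a + d b" "d (a * b) = d a * b + a * d b" "d 0 = 0" "d 1 = 0"
    "d (- a) = - d a" "d (a - b) = d a - d b"
proof -
  show 1: "d (a + b) = d a + d b" "d (a * b) = d a * b + a * d b" for a b
    using d unfolding derivation_def by blast+
  show 0: "d 0 = 0" using 1(1)[of 0 0] by simp
  show "d 1 = 0" using 1(2)[of 1 1] by simp
  show 2: "d (- a) = - d a" for a
    using 1(1)[of a "- a"] 0 by (simp add: eq_neg_iff_add_eq_0 add.commute)
  show "d (a - b) = d a - d b" using 1(1)[of a "- b"] 2 by simp
qed

text \<open>The extension of the derivation \<open>\<delta>\<close> to polynomials that sends the indeterminate to \<open>t\<close>.\<close>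

definition poly_derivation :: "('a::idom \<Rightarrow> 'a) \<Rightarrow> 'a poly \<Rightarrow> 'a poly \<Rightarrow> 'a poly" where
  "poly_derivation \<delta> t p = map_poly \<delta> p + t * pderiv p"

text \<open>The chain rule: \<open>t\<close> encodes the derivative of the point \<open>v\<close>.
  Induction on the coefficient list reduces it to the product rule.\<close>

lemma derivation_poly:
  assumes d: "derivation d" and h: "ring_homomorphism h" and "\<delta> 0 = 0"
    and dh: "\<And>r. d (h r) = h (\<delta> r)" and v: "d v = poly (map_poly h t) v"
  shows "d (poly (map_poly h p) v) = poly (map_poly h (poly_derivation \<delta> t p)) v"
proof (induction p)
  case 0
  show ?case by (simp add: poly_derivation_def derivation_simps[OF d])
next
  case (pCons a p)
  note E = ring_homomorphism_simps[OF ring_homomorphism_eval[OF h, of v]]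
  have 0: "h 0 = 0" by (rule ring_homomorphism_simps(2)[OF h])
  have X: "poly (map_poly h (pCons b q)) v = h b + v * poly (map_poly h q) v" for b q
    using pCons by (simp add: map_poly_pCons 0)
  have D: "poly_derivation \<delta> t (pCons a p) = pCons (\<delta> a) (poly_derivation \<delta> t p) + t * p"
    using pCons by (simp add: poly_derivation_def pderiv_pCons map_poly_pCons \<open>\<delta> 0 = 0\<close> algebra_simps)
  show ?case
    unfolding D E X derivation_simps[OF d] pCons.IH dh v by (simp add: algebra_simps)
qed

text \<open>The chain rule at \<open>e\<close>, then at \<open>v\<close>. The equation
  \<open>e' = b e\<close> becomes \<open>[:0, b:]\<close>; the right-hand side \<open>g e\<close> of
  \<open>v' = g e\<close> is constant in the outer indeterminate, hence
  \<open>[:[:0, g:]:]\<close>.\<close>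

lemma derivation_bivariate_poly:
  fixes h :: "'k::field \<Rightarrow> 'l::field"
  assumes d: "derivation d" and \<delta>: "derivation \<delta>" and h: "ring_homomorphism h"
    and dh: "\<And>r. d (h r) = h (\<delta> r)" and e: "d e = h b * e" and v: "d v = h g * e"
  defines "E \<equiv> \<lambda>P. poly (map_poly (\<lambda>p. poly (map_poly h p) e) P) v"
  shows "d (E P) = E (poly_derivation (poly_derivation \<delta> [:0, b:]) [:[:0, g:]:] P)"
  unfolding E_def
proof (rule derivation_poly[OF d ring_homomorphism_eval[OF h]])
  note hs = ring_homomorphism_simps[OF h]
  show "poly_derivation \<delta> [:0, b:] 0 = 0" by (simp add: poly_derivation_def)
  show "d (poly (map_poly h r) e) = poly (map_poly h (poly_derivation \<delta> [:0, b:] r)) e" for r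
    by (rule derivation_poly[OF d h _ dh])
       (simp_all add: derivation_simps[OF \<delta>] hs e map_poly_pCons)
  show "d v = poly (map_poly (\<lambda>p. poly (map_poly h p) e) [:[:0, g:]:]) v"
    by (simp add: v hs map_poly_pCons mult.commute)
qed

lemma exponential_and_integral_independent:
  fixes h :: "'k::field \<Rightarrow> 'l::field"
  assumes d: "derivation d" and \<delta>: "derivation \<delta>" and h: "ring_homomorphism h"
    and dh: "\<And>r. d (h r) = h (\<delta> r)" and e: "d e = h b * e" and v: "d v = h g * e"
    and "e \<noteq> 0"
    and no_exp: "\<And>a k. k > 0 \<Longrightarrow> \<delta> a = of_nat k * b * a \<Longrightarrow> a = 0"
    and no_int: "\<And>a k. k > 0 \<Longrightarrow> \<delta> a + b * a \<noteq> of_nat k * g"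
    and root: "poly (map_poly (\<lambda>p. poly (map_poly h p) e) P) v = 0"
  shows "P = 0"
proof -
  note hs = ring_homomorphism_simps[OF h]
  note ds = derivation_simps[OF \<delta>]
  define E where "E = (\<lambda>P. poly (map_poly (\<lambda>p. poly (map_poly h p) e) P) v)"
  have "ring_homomorphism E"
    unfolding E_def by (intro ring_homomorphism_eval h)
  note Es = ring_homomorphism_simps[OF this]
  define D where "D = poly_derivation \<delta> [:0, b:]"
  define DD where "DD = poly_derivation D [:[:0, g:]:]"
  have dE: "d (E P) = E (DD P)" for P
    unfolding E_def D_def DD_def by (rule derivation_bivariate_poly[OF d \<delta> h dh e v])
  have D: "coeff (D p) i = \<delta> (coeff p i) + of_nat i * b * coeff p i" for p i
    by (cases i) (simp_all add: D_def poly_derivation_def coeff_map_poly ds coeff_pderiv algebra_simps)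
  have "D 0 = 0" by (simp add: D_def poly_derivation_def)
  then have DD: "coeff (DD P) j = D (coeff P j) + [:0, g:] * (of_nat (Suc j) * coeff P (Suc j))" for P j
    by (simp add: DD_def poly_derivation_def coeff_map_poly coeff_pderiv)
  have "P \<noteq> 0 \<Longrightarrow> E P \<noteq> 0" for P
  proof (induction "(degree P, degree (lead_coeff P))" arbitrary: P
      rule: wf_induct_rule[OF wf_lex_prod[OF wf_less_than wf_less_than]])
    case (1 P)
    define N where "N = degree P"
    define n where "n = degree (lead_coeff P)"
    define q where "q = coeff (coeff P N) n"
    have "q \<noteq> 0" using \<open>P \<noteq> 0\<close> unfolding q_def n_def N_def by simp
    \<comment> \<open>Scaling makes the top coefficient \<open>1\<close>, whose derivative vanishes.
      At that position \<open>DD P1\<close> has coefficient \<open>of_nat n * b\<close>, so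
      \<open>R\<close> vanishes there.\<close>
    define P1 where "P1 = smult [:inverse q:] P"
    define R where "R = DD P1 - smult [:of_nat n * b:] P1"
    define Q where "Q = coeff P1 N"
    have Q: "coeff Q n = 1" "\<And>i. i > n \<Longrightarrow> coeff Q i = 0"
      using \<open>q \<noteq> 0\<close> unfolding Q_def P1_def by (simp_all flip: q_def) (simp add: N_def n_def coeff_eq_0)
    have P1: "\<And>j. j > N \<Longrightarrow> coeff P1 j = 0"
      unfolding P1_def N_def by (simp add: coeff_eq_0)
    have R: "coeff R j = D (coeff P1 j) + [:0, g:] * (of_nat (Suc j) * coeff P1 (Suc j))
        - smult (of_nat n * b) (coeff P1 j)" for j
      unfolding R_def by (simp add: DD)
    have RN: "coeff (coeff R N) i = \<delta> (coeff Q i) + of_nat i * b * coeff Q i - of_nat n * b * coeff Q i" for i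
      unfolding R using P1[of "Suc N"] by (simp add: D Q_def)
    show ?case
    proof
      assume "E P = 0"
      have E_smult: "E (smult p S) = E [:p:] * E S" for p S
        using Es(4)[of "[:p:]" S] by (simp del: poly_mult)
      have "E P1 = 0" unfolding P1_def E_smult \<open>E P = 0\<close> by simp
      have "E R = 0"
        unfolding R_def Es(6) E_smult dE[symmetric] \<open>E P1 = 0\<close> derivation_simps[OF d] by simp
      have "R = 0"
      proof (rule ccontr)
        assume "R \<noteq> 0"
        have "coeff R j = 0" if "j > N" for j
          unfolding R using P1 that by (simp add: \<open>D 0 = 0\<close>)
        then have "degree R \<le> N" by (simp add: degree_le)
        \<comment> \<open>If the degree in \<open>v\<close> does not drop, the leading coefficient
          loses its term of degree \<open>n\<close> and gains none above, so \<open>R\<close> is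
          lexicographically smaller than \<open>P\<close>.\<close>
        moreover have "degree (lead_coeff R) < n" if "degree R = N"
        proof (rule ccontr)
          assume "\<not> degree (lead_coeff R) < n"
          then have "coeff (coeff R N) (degree (lead_coeff R)) = 0"
            unfolding RN using Q by (cases "degree (lead_coeff R) = n") (auto simp: ds)
          then show False using \<open>R \<noteq> 0\<close> that by (metis leading_coeff_0_iff)
        qed
        ultimately have "((degree R, degree (lead_coeff R)), (degree P, degree (lead_coeff P)))
            \<in> less_than <*lex*> less_than"
          unfolding N_def n_def by auto
        then show False using "1.hyps" \<open>R \<noteq> 0\<close> \<open>E R = 0\<close> by blast
      qed
      \<comment> \<open>With \<open>R = 0\<close>, each lower coefficient of \<open>Q\<close> solves
        \<open>a' = (n - i) b a\<close>, where \<open>n - i\<close> is positive.\<close>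
      have "coeff Q i = 0" if "i < n" for i
      proof (rule no_exp)
        show "n - i > 0" using that by simp
        show "\<delta> (coeff Q i) = of_nat (n - i) * b * coeff Q i"
          using RN[of i] \<open>R = 0\<close> that by (simp add: of_nat_diff algebra_simps)
      qed
      then have Qn: "Q = monom 1 n"
        using Q by (intro poly_eqI) (metis coeff_monom linorder_neqE_nat)
      show False
      proof (cases N)
        case 0
        then have "P1 = [:monom 1 n:]"
          using P1 Qn Q_def by (intro poly_eqI) (simp add: coeff_pCons split: nat.split)
        then have "E P1 = e ^ n"
          unfolding E_def by (simp add: map_poly_pCons map_poly_monom hs poly_monom)
        then show False using \<open>E P1 = 0\<close> \<open>e \<noteq> 0\<close> by simp
      next
        case (Suc M)
        define a where "a = coeff (coeff P1 M) (Suc n)"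
        \<comment> \<open>Differentiating \<open>v\<close> in the leading term adds
          \<open>N g\<close> at this position. For \<open>a\<close> itself, the factor
          \<open>n + 1\<close> from \<open>D\<close> minus the \<open>n\<close> subtracted in
          \<open>R\<close> leaves one \<open>b * a\<close>. The sign is then absorbed by passing to
          \<open>- a\<close>.\<close>
        have "coeff (coeff R M) (Suc n) = \<delta> a + b * a + of_nat N * g"
          unfolding R using Q(1) Suc
          by (simp add: D a_def Q_def of_nat_poly algebra_simps)
        then have "\<delta> a + b * a = - (of_nat N * g)"
          using \<open>R = 0\<close> by (simp add: eq_neg_iff_add_eq_0)
        moreover have "\<delta> (- a) + b * (- a) = - (\<delta> a + b * a)"
          by (simp add: ds)
        ultimately have "\<delta> (- a) + b * (- a) = of_nat N * g"
          by (simp only: minus_minus)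
        then show False using no_int[of N "- a"] Suc by simp
      qed
    qed
  qed
  then show ?thesis using root unfolding E_def by blast
qed

section \<open>Rational solutions of the auxiliary equations\<close>

lemma to_fract_of_nat_poly: "to_fract [:of_nat k:] = (of_nat k :: ratfun)"
proof (induction k)
  case (Suc k)
  have "to_fract [:of_nat (Suc k) :: complex:] = to_fract (1 + [:of_nat k:])"
    by (simp add: one_pCons)
  also have "\<dots> = of_nat (Suc k)"
    unfolding to_fract_add Suc.IH by simp
  finally show ?case .
qed simp

lemma to_fract_numeral_poly: "to_fract [:numeral k:] = (numeral k :: ratfun)"
  using to_fract_of_nat_poly[of "numeral k"] by simp

lemma linear_denominator: "xK + 1 = to_fract [:1, 1:]"
  unfolding xK_def by (simp flip: to_fract_add to_fract_1 add: one_pCons)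

lemma denominator_nonzero: "xK + 1 \<noteq> 0"
  unfolding linear_denominator by simp

lemma ratfun_cases:
  obtains p q where "q \<noteq> 0" "coprime p q" "(r :: ratfun) = to_fract p / to_fract q"
proof -
  show ?thesis
    using that[of "snd (quot_of_fract r)" "fst (quot_of_fract r)"]
      coprime_quot_of_fract[of r] snd_quot_of_fract_nonzero[of r]
    by (simp add: coprime_commute flip: Fract_conv_to_fract)
qed

text \<open>A comparison at infinity: differentiation lowers a degree, so the left side is zero or
  has degree at most \<open>degree p + degree q\<close>, while the right side has one more.\<close>

lemma wronskian_mult_linear_neq:
  fixes p q :: "complex poly"
  assumes "p \<noteq> 0" "q \<noteq> 0" "c \<noteq> 0"
  shows "(pderiv p * q - p * pderiv q) * [:1, 1:] \<noteq> [:0, c:] * (p * q)"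
proof
  assume eq: "(pderiv p * q - p * pderiv q) * [:1, 1:] = [:0, c:] * (p * q)"
  have r: "degree ([:0, c:] * (p * q)) = 1 + degree p + degree q"
    using assms by (simp add: degree_mult_eq)
  let ?w = "pderiv p * q - p * pderiv q"
  have "degree (pderiv p * q) \<le> degree p - 1 + degree q" "degree (p * pderiv q) \<le> degree p + (degree q - 1)"
    using degree_mult_le[of "pderiv p" q] degree_mult_le[of p "pderiv q"] by (simp_all add: degree_pderiv)
  moreover have "pderiv p = 0" if "degree p = 0" using that pderiv_eq_0_iff by blast
  moreover have "pderiv q = 0" if "degree q = 0" using that pderiv_eq_0_iff by blast
  ultimately have "?w = 0 \<or> degree ?w < degree p + degree q"
    by (cases "degree p = 0"; cases "degree q = 0")
       (auto simp: degree_pderiv intro!: le_less_trans[OF degree_diff_le_max])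
  then show False
  proof
    assume "?w = 0" then show False using eq r by simp
  next
    assume "degree ?w < degree p + degree q"
    moreover have "degree (?w * [:1, 1:]) \<le> degree ?w + 1"
      using degree_mult_le[of ?w "[:1, 1:]"] by simp
    ultimately show False using eq r by simp
  qed
qed

text \<open>Here \<open>p / q\<close> would solve \<open>(x + 1) a' + 2 x a = c\<close> in lowest
  terms. The denominator can vanish only at \<open>-1\<close>, a pole there is impossible, and for a
  polynomial solution the top degree of \<open>2 x a\<close> cannot cancel.\<close>

lemma no_fraction_solution_of_auxiliary_equation:
  fixes p q :: "complex poly"
  assumes "q \<noteq> 0" "coprime p q" "c \<noteq> 0"
    and eq: "(pderiv p * q - p * pderiv q) * [:1, 1:] + [:0, 2:] * p * q = [:c:] * q * q"
  shows False
proof -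
  have "q * (pderiv p * [:1, 1:] + [:0, 2:] * p - [:c:] * q) = p * (pderiv q * [:1, 1:])"
    using eq by (simp add: algebra_simps)
  then have "q dvd p * (pderiv q * [:1, 1:])" by (metis dvd_triv_left)
  then have "q dvd pderiv q * [:1, 1:]"
    using \<open>coprime p q\<close> coprime_commute coprime_dvd_mult_right_iff by blast
  then obtain t where t: "pderiv q * [:1, 1:] = q * t" by (rule dvdE)
  \<comment> \<open>The cofactor \<open>t\<close> is constant because the linear factor restores the
    degree lost in \<open>pderiv q\<close>; leading coefficients identify it as
    \<open>degree q\<close>. In effect \<open>q\<close> is a constant times a power of
    \<open>x + 1\<close>.\<close>
  obtain m where m: "pderiv q * [:1, 1:] = smult (of_nat m) q" "m = degree q"
  proof -
    show ?thesis
    proof (cases "degree q = 0")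
      case True
      then have "pderiv q = 0" by (simp add: pderiv_eq_0_iff)
      with True show ?thesis using that[of "0"] by simp
    next
      case False
      then have nz: "pderiv q \<noteq> 0" by (simp add: pderiv_eq_0_iff)
      then have "pderiv q * [:1, 1:] \<noteq> 0" by (simp del: mult_pCons_right)
      then have "t \<noteq> 0" using t by auto
      have "degree (pderiv q * [:1, 1:]) = degree (pderiv q) + 1"
        using nz by (subst degree_mult_eq) auto
      then have dg: "degree (pderiv q * [:1, 1:]) = degree q"
        using False by (simp add: degree_pderiv)
      then have "degree t = 0" using t \<open>q \<noteq> 0\<close> \<open>t \<noteq> 0\<close> by (simp add: degree_mult_eq)
      then obtain u where u: "t = [:u:]" by (rule degree_eq_zeroE)
      have "lead_coeff (pderiv q * [:1, 1:]) = lead_coeff (pderiv q)" by (simp add: lead_coeff_mult del: mult_pCons_right)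
      also have "\<dots> = of_nat (degree q) * lead_coeff q" using False by (simp add: degree_pderiv coeff_pderiv)
      finally have "of_nat (degree q) * lead_coeff q = u * lead_coeff q"
        using t u \<open>q \<noteq> 0\<close> by (auto simp add: lead_coeff_mult simp del: mult_pCons_right)
      then have "of_nat (degree q) = u" using \<open>q \<noteq> 0\<close> by simp
      then show ?thesis using that[of "degree q"] t u by (simp del: mult_pCons_right) (simp add: mult.commute)
    qed
  qed
  have "q * (pderiv p * [:1, 1:] + [:0, 2:] * p - [:c:] * q) = q * smult (of_nat m) p"
    using \<open>q * _ = p * _\<close> unfolding m(1) by (simp add: algebra_simps)
  then have eq2: "pderiv p * [:1, 1:] + [:0, 2:] * p - [:c:] * q = smult (of_nat m) p"
    using \<open>q \<noteq> 0\<close> mult_left_cancel by blast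
  \<comment> \<open>So the only possible pole is \<open>-1\<close>, and there the leading coefficients of \<open>(x+1) a'\<close> and \<open>2 x a\<close>,
   proportional to \<open>-m\<close> and \<open>-2\<close>, cannot cancel.\<close>
  have "m = 0"
  proof (rule ccontr)
    assume "m \<noteq> 0"
    have "poly (smult (of_nat m) q) (-1) = 0" unfolding m(1)[symmetric] by simp
    then have q1: "poly q (-1) = 0" using \<open>m \<noteq> 0\<close> by simp
    have *: "-2 * poly p (-1) = of_nat m * poly p (-1)"
      using arg_cong[OF eq2, of "\<lambda>p. poly p (-1)"] q1 by simp
    have "(of_nat (m + 2)) * poly p (-1) = of_nat m * poly p (-1) + 2 * poly p (-1)" by (simp add: algebra_simps)
    also have "\<dots> = 0" unfolding *[symmetric] by simp
    finally have "(of_nat (m + 2)) * poly p (-1) = 0" .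
    then have "poly p (-1) = 0" by (simp only: mult_eq_0_iff of_nat_eq_0_iff) simp
    then show False using q1 \<open>coprime p q\<close>
      by (metis coprime_poly_0)
  qed
  then have "degree q = 0" using m by simp
  then obtain u where u: "q = [:u:]" by (rule degree_eq_zeroE)
  with \<open>q \<noteq> 0\<close> have "u \<noteq> 0" by simp
  \<comment> \<open>With a constant denominator only degrees remain: the first summand has degree at
    most \<open>degree p\<close>, the second exactly \<open>degree p + 1\<close>, the right side
    \<open>0\<close>.\<close>
  have eq3: "pderiv p * [:1, 1:] + [:0, 2:] * p = [:c * u:]" using eq2 u \<open>m = 0\<close> by (simp add: algebra_simps)
  have "p \<noteq> 0" using eq3 \<open>u \<noteq> 0\<close> \<open>c \<noteq> 0\<close> by auto
  then have d: "degree ([:0, 2:] * p) = degree p + 1" by (subst degree_mult_eq) auto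
  have "degree (pderiv p * [:1, 1:]) \<le> degree p"
    using degree_mult_le[of "pderiv p" "[:1, 1:]"] pderiv_eq_0_iff[of p]
    by (cases "degree p = 0") (simp_all add: degree_pderiv del: mult_pCons_right)
  then have "degree (pderiv p * [:1, 1:] + [:0, 2:] * p) = degree p + 1"
    using d by (subst degree_add_eq_right) auto
  then show False unfolding eq3 by simp
qed

lemma no_exponential_in_ratfun:
  fixes a :: ratfun
  assumes "k > 0" and eq: "fract_pderiv a = of_nat k * (2 * xK / (xK + 1)) * a"
  shows "a = 0"
proof (rule ccontr)
  assume "a \<noteq> 0"
  obtain p q where q: "q \<noteq> 0" and a: "a = to_fract p / to_fract q"
    by (rule ratfun_cases[of a])
  with \<open>a \<noteq> 0\<close> have p: "p \<noteq> 0" by auto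
  let ?w = "pderiv p * q - p * pderiv q"
  have "to_fract ?w * (xK + 1)
      = fract_pderiv a * to_fract q * to_fract q * (xK + 1)"
    using q unfolding a fract_pderiv_divide[OF q] by (simp del: to_fract_diff)
  also have "\<dots> = of_nat k * (2 * xK) * to_fract p * to_fract q"
    using q denominator_nonzero unfolding eq unfolding a by simp
  also have "of_nat k * (2 * xK) = to_fract [:0, 2 * of_nat k:]"
    unfolding xK_def
    by (simp flip: to_fract_of_nat_poly to_fract_numeral_poly to_fract_mult)
  finally have "to_fract (?w * [:1, 1:]) = to_fract ([:0, 2 * of_nat k:] * (p * q))"
    unfolding linear_denominator by (simp only: to_fract_mult mult.assoc)
  then have "?w * [:1, 1:] = [:0, 2 * of_nat k:] * (p * q)"
    by (simp only: to_fract_eq_iff)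
  then show False
    using wronskian_mult_linear_neq[OF p q, of "2 * of_nat k"] \<open>k > 0\<close> by simp
qed

text \<open>Multiplying by \<open>(x + 1) q^2\<close> gives the polynomial identity excluded above.
  The fraction is taken in lowest terms because the pole argument relies on coprimality.\<close>

lemma no_rational_solution:
  fixes a :: ratfun
  assumes "k > 0"
  shows "fract_pderiv a + 2 * xK / (xK + 1) * a \<noteq> of_nat k * (12 / (xK + 1))"
proof
  assume eq: "fract_pderiv a + 2 * xK / (xK + 1) * a = of_nat k * (12 / (xK + 1))"
  obtain p q where q: "q \<noteq> 0" "coprime p q" and a: "a = to_fract p / to_fract q"
    by (rule ratfun_cases[of a])
  let ?w = "pderiv p * q - p * pderiv q"
  let ?d = "fract_pderiv a"
  have *: "?d = to_fract ?w / (to_fract q * to_fract q)"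
    unfolding a fract_pderiv_divide[OF q(1)] by simp
  have "to_fract ?w * (xK + 1) + 2 * xK * to_fract p * to_fract q
      = (?d + 2 * xK / (xK + 1) * a) * (xK + 1) * to_fract q * to_fract q"
  proof -
    have "w * x + t * u * v = (w / (v * v) + t / x * (u / v)) * x * v * v"
      if "x \<noteq> 0" "v \<noteq> 0" for w x t u v :: ratfun
      using that by (simp add: field_simps)
    from this[of "xK + 1" "to_fract q" "to_fract ?w" "2 * xK" "to_fract p"] show ?thesis
      using q denominator_nonzero unfolding * unfolding a by (simp del: to_fract_diff)
  qed
  also have "\<dots> = of_nat k * 12 * to_fract q * to_fract q"
    using denominator_nonzero unfolding eq by simp
  also have "(of_nat k * 12 :: ratfun) = to_fract [:12 * of_nat k:]"
    by (simp flip: to_fract_of_nat_poly to_fract_numeral_poly to_fract_mult)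
  also have "(2 * xK :: ratfun) = to_fract [:0, 2:]"
    unfolding xK_def by (simp flip: to_fract_numeral_poly to_fract_mult)
  finally have "to_fract (?w * [:1, 1:] + [:0, 2:] * p * q) = to_fract ([:12 * of_nat k:] * q * q)"
    unfolding linear_denominator by (simp only: to_fract_mult to_fract_add)
  then have "?w * [:1, 1:] + [:0, 2:] * p * q = [:12 * of_nat k:] * q * q"
    by (simp only: to_fract_eq_iff)
  then show False
    using no_fraction_solution_of_auxiliary_equation[OF q, of "12 * of_nat k"] \<open>k > 0\<close> by simp
qed

section \<open>The coefficients of the linearized variational equation\<close>

lemma fract_pderiv_0: "fract_pderiv (0 :: 'a::idom poly fract) = 0"
  using fract_pderiv_divide[of "1 :: 'a poly" 0] by simp

lemma has_value_along_0:
  assumes "coeff q 0 \<noteq> 0"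
  shows "has_value_along 0 (to_fract p / to_fract q) (to_fract (coeff p 0) / to_fract (coeff q 0))"
  unfolding has_value_along_def
  using assms by (intro exI[of _ p] exI[of _ q]) (simp add: poly_0_coeff_0 coeff_map_poly)

lemma gradient_slope_of_potential:
  fixes F :: "complex poly poly"
  assumes F: "F = cst2 (1/3) * X ^ 3 + cst2 (1/2) * X ^ 2 + (X + Y) ^ 2 * Y ^ 2 + cst2 (1/4) * Y ^ 4"
  shows "gradient_slope F = to_fract (2 * (X + Y) * Y ^ 2 + 2 * (X + Y) ^ 2 * Y + Y ^ 3)
           / to_fract (X ^ 2 + X + 2 * (X + Y) * Y ^ 2)"
    and "gradient_slope F = to_fract [:0, [:0, 0, 2:], [:0, 6:], [:5:]:]
           / to_fract [:[:0, 1, 1:], 0, [:0, 2:], [:2:]:]"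
proof -
  \<comment> \<open>Expansion in powers of \<open>y\<close>; the entry \<open>5/4\<close> combines
    \<open>1\<close> from \<open>(X + Y) ^ 2 * Y ^ 2\<close> with the quartic term.\<close>
  have F': "F = [:[:0, 0, 1/2, 1/3:], 0, [:0, 0, 1:], [:0, 2:], [:5/4:]:]"
    unfolding F X_def Y_def cst2_def by (simp add: eval_nat_numeral one_pCons)
  have *: "2 * (X + Y) * Y ^ 2 + 2 * (X + Y) ^ 2 * Y + Y ^ 3 = [:0, [:0, 0, 2:], [:0, 6:], [:5:]:]"
    "X ^ 2 + X + 2 * (X + Y) * Y ^ 2 = [:[:0, 1, 1:], 0, [:0, 2:], [:2:]:]"
    unfolding X_def Y_def by (simp_all add: eval_nat_numeral one_pCons numeral_poly)
  show "gradient_slope F = to_fract [:0, [:0, 0, 2:], [:0, 6:], [:5:]:]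
           / to_fract [:[:0, 1, 1:], 0, [:0, 2:], [:2:]:]"
    unfolding gradient_slope_def F' by (simp add: pderiv_pCons map_poly_pCons numeral_poly)
  then show "gradient_slope F = to_fract (2 * (X + Y) * Y ^ 2 + 2 * (X + Y) ^ 2 * Y + Y ^ 3)
           / to_fract (X ^ 2 + X + 2 * (X + Y) * Y ^ 2)"
    unfolding * .
qed

lemma funpow_2: "(f ^^ 2) x = f (f x)"
  by (simp add: numeral_2_eq_2)

text \<open>The quotient rule is iterated without cancelling. Each denominator is a power of
  \<open>q\<close>, hence has nonzero constant coefficient in \<open>y\<close>, and the value along
  \<open>y = 0\<close> is a quotient of constant coefficients.\<close>

lemma \<beta>_divide:
  fixes p q :: "complex poly poly"
  assumes q: "coeff q 0 \<noteq> 0"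
  defines "w \<equiv> pderiv p * q - p * pderiv q"
  shows "\<beta> (to_fract p / to_fract q) 1 = to_fract (coeff w 0) / to_fract (coeff (q * q) 0)"
    and "\<beta> (to_fract p / to_fract q) 2
      = to_fract (coeff (pderiv w * (q * q) - w * pderiv (q * q)) 0) / to_fract (coeff (q * q * (q * q)) 0)"
proof -
  have nz: "q \<noteq> 0" "q * q \<noteq> 0" "coeff (q * q) 0 \<noteq> 0" "coeff (q * q * (q * q)) 0 \<noteq> 0"
    using q by (auto simp flip: poly_0_coeff_0)
  have "(fract_pderiv ^^ 1) (to_fract p / to_fract q) = to_fract w / to_fract (q * q)"
    unfolding w_def by (simp only: funpow.simps One_nat_def o_apply id_apply fract_pderiv_divide[OF nz(1)])
  then show "\<beta> (to_fract p / to_fract q) 1 = to_fract (coeff w 0) / to_fract (coeff (q * q) 0)"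
    unfolding \<beta>_def by (simp only: value_along_eqI[OF has_value_along_0[OF nz(3)]])
  have "(fract_pderiv ^^ 2) (to_fract p / to_fract q) = fract_pderiv (to_fract w / to_fract (q * q))"
    unfolding w_def by (simp only: funpow_2 fract_pderiv_divide[OF nz(1)])
  also have "\<dots> = to_fract (pderiv w * (q * q) - w * pderiv (q * q)) / to_fract (q * q * (q * q))"
    by (rule fract_pderiv_divide[OF nz(2)])
  finally show "\<beta> (to_fract p / to_fract q) 2
      = to_fract (coeff (pderiv w * (q * q) - w * pderiv (q * q)) 0) / to_fract (coeff (q * q * (q * q)) 0)"
    unfolding \<beta>_def by (simp only: value_along_eqI[OF has_value_along_0[OF nz(4)]])
qed

lemma LVE2_coefficients:
  assumes f: "f = to_fract [:0, [:0, 0, 2:], [:0, 6:], [:5:]:]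
           / to_fract [:[:0, 1, 1:], 0, [:0, 2:], [:2:]:]"
  shows "is_particular_solution f 0"
    and "\<beta> f 1 = 2 * xK / (xK + 1)" and "\<beta> f 2 = 12 / (xK + 1)"
proof -
  show "is_particular_solution f 0"
    using has_value_along_0[of "[:[:0, 1, 1:], 0, [:0, 2:], [:2:]:]" "[:0, [:0, 0, 2:], [:0, 6:], [:5:]:]"]
    unfolding is_particular_solution_def fract_pderiv_0 f by simp
  have xK: "2 * xK / (xK + 1) = to_fract [:0, 2:] / to_fract [:1, 1:]"
    "12 / (xK + 1) = to_fract [:12:] / to_fract [:1, 1:]"
    unfolding linear_denominator unfolding xK_def
    by (simp_all flip: to_fract_numeral_poly to_fract_mult)
  \<comment> \<open>Powers of \<open>x^2 + x\<close> remain uncancelled in the quotients, so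
    equality is checked by cross-multiplication.\<close>
  show "\<beta> f 1 = 2 * xK / (xK + 1)"
    unfolding xK f by (subst \<beta>_divide)
     (simp_all add: frac_eq_eq pderiv_pCons flip: to_fract_mult)
  show "\<beta> f 2 = 12 / (xK + 1)"
    unfolding xK f by (subst \<beta>_divide)
     (simp_all add: frac_eq_eq pderiv_pCons flip: to_fract_mult)
qed

section \<open>Polynomial curves in the Zariski topology\<close>

lemma matrix_polynomial_along_curve:
  fixes f :: "complex \<Rightarrow> complex^'n^'m"
  assumes f: "\<And>i j. \<exists>p. \<forall>s. f s $ i $ j = poly p s"
    and "matrix_polynomial r"
  shows "\<exists>p. \<forall>s. r (f s) = poly p s"
  using assms(2)
proof induction
  case (const c)
  show ?case by (rule exI[of _ "[:c:]"]) simp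
next
  case (add p q)
  then show ?case by (metis poly_add)
next
  case (mult p q)
  then show ?case by (metis poly_mult)
qed (rule f)

text \<open>A Zariski open set meeting the curve contains \<open>f s\<close> for all but finitely
  many \<open>s\<close>, since a nonzero polynomial has finitely many roots. Two such sets therefore
  meet at some parameter of the infinite set \<open>S\<close>.\<close>

lemma connectedin_zariski_curve:
  fixes f :: "complex \<Rightarrow> complex^'n^'m"
  assumes f: "\<And>i j. \<exists>p. \<forall>s. f s $ i $ j = poly p s" and "infinite S"
  shows "connectedin zariski_topology (f ` S)"
proof -
  have cofinite: "finite {s. f s \<notin> E}"
    if E: "openin zariski_topology E" "E \<inter> f ` S \<noteq> {}" for E
  proof -
    obtain P where P: "\<forall>r\<in>P. matrix_polynomial r" "- E = {M. \<forall>r\<in>P. r M = 0}"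
      using \<open>openin _ E\<close> unfolding openin_zariski_topology zariski_closed_def by blast
    obtain s where "f s \<in> E" using E(2) by blast
    then obtain r where r: "r \<in> P" "r (f s) \<noteq> 0" using P(2) by blast
    obtain p where p: "\<forall>s. r (f s) = poly p s"
      using matrix_polynomial_along_curve[OF f] P(1) r(1) by blast
    have "{s. f s \<notin> E} \<subseteq> {s. poly p s = 0}"
    proof safe
      fix s assume "f s \<notin> E"
      then have "f s \<in> - E" by simp
      then show "poly p s = 0" unfolding P(2) using r(1) p by auto
    qed
    moreover have "p \<noteq> 0" using r(2) p by auto
    ultimately show ?thesis using poly_roots_finite finite_subset by blast
  qed
  have "topspace zariski_topology = (UNIV :: (complex^'n^'m) set)"
  proof -
    have "zariski_closed ({} :: (complex^'n^'m) set)"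
      unfolding zariski_closed_def
      by (rule exI[of _ "{\<lambda>M. 1}"]) (auto intro: matrix_polynomial.const)
    then have "openin zariski_topology (UNIV :: (complex^'n^'m) set)"
      by (simp add: openin_zariski_topology)
    then show ?thesis
      by (simp add: openin_subset top.extremum_uniqueI)
  qed
  moreover have False
    if E: "openin zariski_topology E1" "openin zariski_topology E2"
      "E1 \<inter> E2 \<inter> f ` S = {}" "E1 \<inter> f ` S \<noteq> {}" "E2 \<inter> f ` S \<noteq> {}" for E1 E2
  proof -
    have "S \<subseteq> {s. f s \<notin> E1} \<union> {s. f s \<notin> E2}" using E(3) by blast
    then show False
      using cofinite[OF E(1,4)] cofinite[OF E(2,5)] \<open>infinite S\<close>
      by (meson finite_UnI finite_subset)
  qed
  ultimately show ?thesis unfolding connectedin by (metis subset_UNIV)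
qed

text \<open>This exhibits elements of the component without determining the whole group.\<close>

lemma curve_in_identity_component:
  fixes f :: "complex \<Rightarrow> complex^'n^'n"
  assumes f: "\<And>i j. \<exists>p. \<forall>s. f s $ i $ j = poly p s" and "infinite S" "f ` S \<subseteq> G" "mat 1 \<in> f ` S"
  shows "f ` S \<subseteq> identity_component G"
  unfolding identity_component_def connected_component_of_def
  using connectedin_zariski_curve[OF f \<open>infinite S\<close>] assms(3,4)
  by (auto simp: connectedin_subtopology)

section \<open>The differential Galois group\<close>

lemma derivation_fract_pderiv: "derivation (fract_pderiv :: ratfun \<Rightarrow> ratfun)"
  unfolding derivation_def
proof (intro conjI allI)
  fix a b :: ratfun
  obtain p q where a: "q \<noteq> 0" "a = to_fract p / to_fract q" by (rule ratfun_cases[of a])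
  obtain r s where b: "s \<noteq> 0" "b = to_fract r / to_fract s" by (rule ratfun_cases[of b])
  have qs: "q * s \<noteq> 0" using a b by simp
  have ab: "a + b = to_fract (p * s + r * q) / to_fract (q * s)" "a * b = to_fract (p * r) / to_fract (q * s)"
    unfolding a b using a(1) b(1) by (simp_all add: field_simps)
  show "fract_pderiv (a + b) = fract_pderiv a + fract_pderiv b"
    unfolding ab fract_pderiv_divide[OF qs] unfolding a(2) b(2) fract_pderiv_divide[OF a(1)] fract_pderiv_divide[OF b(1)]
    using a(1) b(1) by (simp add: pderiv_mult pderiv_add field_simps)
  show "fract_pderiv (a * b) = fract_pderiv a * b + a * fract_pderiv b"
    unfolding ab fract_pderiv_divide[OF qs] unfolding a(2) b(2) fract_pderiv_divide[OF a(1)] fract_pderiv_divide[OF b(1)]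
    using a(1) b(1) by (simp add: pderiv_mult field_simps)
qed

lemma fract_pderiv_cst: "fract_pderiv (cst c) = 0"
  using fract_pderiv_divide[of 1 "[:c:]"] by (simp add: cst_def pderiv_pCons)

lemma ring_homomorphism_cst: "ring_homomorphism cst"
  unfolding ring_homomorphism_def cst_def by (simp flip: to_fract_add to_fract_mult one_pCons)

text \<open>Commutation with \<open>d\<close> thus need only be checked on field generators. Closure
  under inverses comes from differentiating \<open>x * inverse x = 1\<close>.\<close>

lemma subfield_commuting_with_derivation:
  fixes \<sigma> d :: "'l::field \<Rightarrow> 'l"
  assumes \<sigma>: "ring_homomorphism \<sigma>" and d: "derivation d"
  shows "is_subfield {x. \<sigma> (d x) = d (\<sigma> x)}"
proof -
  note ss = ring_homomorphism_simps[OF \<sigma>] and ds = derivation_simps[OF d]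
  have inv: "d (inverse x) = - (d x * inverse x * inverse x)" for x
  proof (cases "x = 0")
    case False
    then have "d x * inverse x + x * d (inverse x) = 0"
      using ds(2)[of x "inverse x"] ds(4) by simp
    then have "inverse x * (d x * inverse x + x * d (inverse x)) = 0" by simp
    then have "inverse x * d x * inverse x + d (inverse x) = 0"
      using False by (simp add: distrib_left flip: mult.assoc)
    then show ?thesis by (simp add: eq_neg_iff_add_eq_0 ac_simps)
  qed (simp add: ds)
  show ?thesis
    unfolding is_subfield_def by (auto simp: ss ds inv ring_homomorphism_inverse[OF \<sigma>])
qed

locale exponential_with_integral =
  fixes \<iota> :: "ratfun \<Rightarrow> 'l::field" and d :: "'l \<Rightarrow> 'l" and b g :: ratfun
  assumes \<iota>: "ring_homomorphism \<iota>" and d: "derivation d" and d\<iota>: "\<And>a. d (\<iota> a) = \<iota> (fract_pderiv a)"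
    and no_exp: "\<And>a k. k > 0 \<Longrightarrow> fract_pderiv a = of_nat k * b * a \<Longrightarrow> a = 0"
    and no_int: "\<And>a k. k > 0 \<Longrightarrow> fract_pderiv a + b * a \<noteq> of_nat k * g"
begin

text \<open>\<open>e\<close> is an exponential of an integral of \<open>b\<close>, and
  \<open>v\<close> an integral of \<open>g e\<close>. A predicate is used because automorphisms
  arise by comparing two such pairs.\<close>

definition generating_pair :: "'l \<Rightarrow> 'l \<Rightarrow> bool" where
  "generating_pair e v \<longleftrightarrow> e \<noteq> 0 \<and> d e = \<iota> b * e \<and> d v = \<iota> g * e \<and>
     (\<forall>S. is_subfield S \<and> range \<iota> \<subseteq> S \<and> e \<in> S \<and> v \<in> S \<longrightarrow> S = UNIV)"

text \<open>By algebraic independence, evaluation at either pair identifies the field with the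
  fraction field of the same polynomial ring over \<complex>(x). Commutation with \<open>d\<close>
  holds on the generators, hence everywhere.\<close>

lemma automorphism_between_generating_pairs:
  assumes ev: "generating_pair e v" and ev': "generating_pair e' v'"
  shows "\<exists>\<sigma>\<in>diff_automorphisms \<iota> d. \<sigma> e = e' \<and> \<sigma> v = (v' :: 'l)"
proof -
  note \<iota>s = ring_homomorphism_simps[OF \<iota>]
  define E where "E e v P = poly (map_poly (\<lambda>p. poly (map_poly \<iota> p) e) P) v" for e v :: 'l and P
  have E: "ring_homomorphism (E e v)" for e v
    unfolding E_def by (intro ring_homomorphism_eval \<iota>)
  have E_inj: "P = 0" if "generating_pair e v" "E e v P = 0" for e v P
  proof (rule exponential_and_integral_independent[OF d derivation_fract_pderiv \<iota> d\<iota>])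
    show "d e = \<iota> b * e" "d v = \<iota> g * e" "e \<noteq> 0"
      using that(1) by (simp_all add: generating_pair_def)
    show "poly (map_poly (\<lambda>p. poly (map_poly \<iota> p) e) P) v = 0"
      using that(2) by (simp add: E_def)
  qed (use no_exp no_int in blast)+
  have E_vals: "E e v [:[:a:]:] = \<iota> a" "E e v [:[:0, 1:]:] = e" "E e v [:0, 1:] = v" for e v a
    unfolding E_def by (simp_all add: map_poly_pCons \<iota>s)
  have E_gen: "S = UNIV" if "generating_pair e v" "is_subfield S" "range (E e v) \<subseteq> S" for e v S
  proof -
    have "E e v P \<in> S" for P using that(3) by blast
    from this[of "[:[:_:]:]"] this[of "[:[:0, 1:]:]"] this[of "[:0, 1:]"]
    have "range \<iota> \<subseteq> S" "e \<in> S" "v \<in> S"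
      unfolding E_vals by auto
    then show ?thesis using that(1,2) by (simp add: generating_pair_def)
  qed
  have "\<exists>\<sigma>. bij \<sigma> \<and> ring_homomorphism \<sigma> \<and> (\<forall>P. \<sigma> (E e v P) = E e' v' P)"
    by (rule fraction_field_automorphism)
       (fact E | rule E_inj[OF ev] E_inj[OF ev'] E_gen[OF ev] E_gen[OF ev'], assumption+)+
  then obtain \<sigma> where \<sigma>: "bij \<sigma>" "ring_homomorphism \<sigma>" "\<forall>P. \<sigma> (E e v P) = E e' v' P"
    by blast
  have vals: "\<sigma> (\<iota> a) = \<iota> a" "\<sigma> e = e'" "\<sigma> v = v'" for a
    using \<sigma>(3) E_vals by metis+
  have "{x. \<sigma> (d x) = d (\<sigma> x)} = UNIV"
  proof -
    have "e \<in> {x. \<sigma> (d x) = d (\<sigma> x)}" "v \<in> {x. \<sigma> (d x) = d (\<sigma> x)}"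
      "range \<iota> \<subseteq> {x. \<sigma> (d x) = d (\<sigma> x)}"
      using ev ev' unfolding generating_pair_def
      by (auto simp: vals d\<iota> ring_homomorphism_simps[OF \<sigma>(2)])
    then show ?thesis
      using ev subfield_commuting_with_derivation[OF \<sigma>(2) d] unfolding generating_pair_def by blast
  qed
  then have "\<sigma> \<in> diff_automorphisms \<iota> d"
    unfolding diff_automorphisms_def using \<sigma> vals(1) by blast
  then show ?thesis using vals by blast
qed

text \<open>The new pair satisfies the same two equations, and \<open>e\<close> and \<open>v\<close>
  are recovered from it because \<open>a\<close> is invertible.\<close>

lemma affine_automorphism:
  assumes ev: "generating_pair e v" and "a \<noteq> 0"
  shows "\<exists>\<sigma>\<in>diff_automorphisms \<iota> d. \<sigma> e = \<iota> (cst a) * e \<and> \<sigma> v = \<iota> (cst a) * v + \<iota> (cst c)"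
proof (rule automorphism_between_generating_pairs[OF ev])
  let ?a = "\<iota> (cst a)" and ?c = "\<iota> (cst c)"
  note \<iota>s = ring_homomorphism_simps[OF \<iota>]
  have a: "?a \<noteq> 0"
    using \<open>a \<noteq> 0\<close> by (simp add: ring_homomorphism_inverse[OF \<iota>] cst_def)
  have const: "d (\<iota> (cst c)) = 0" for c
    by (simp add: d\<iota> fract_pderiv_cst \<iota>s)
  show "generating_pair (?a * e) (?a * v + ?c)"
    unfolding generating_pair_def
  proof (intro conjI allI impI)
    fix S assume S: "is_subfield S \<and> range \<iota> \<subseteq> S \<and> ?a * e \<in> S \<and> ?a * v + ?c \<in> S"
    then have mem: "?a \<in> S" "?c \<in> S" by auto
    have sub: "x - y \<in> S" "x * y \<in> S" "inverse x \<in> S" if "x \<in> S" "y \<in> S" for x y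
      using S that unfolding is_subfield_def by blast+
    have "e = inverse ?a * (?a * e)" "v = inverse ?a * ((?a * v + ?c) - ?c)"
      using a by simp_all
    then have "e \<in> S" "v \<in> S"
      using sub S mem by metis+
    then show "S = UNIV" using ev S unfolding generating_pair_def by blast
  qed (use ev a in \<open>auto simp: generating_pair_def derivation_simps[OF d] const\<close>)
qed

end

section \<open>Matrix computations\<close>

lemma map_matrix_mult:
  assumes "ring_homomorphism h"
  shows "map_matrix h (A ** B) = map_matrix h A ** map_matrix h B"
  by (simp add: vec_eq_iff matrix_matrix_mult_def ring_homomorphism_sum[OF assms]
      ring_homomorphism_simps[OF assms])

lemma map_matrix_mat_1:
  assumes "ring_homomorphism h"
  shows "map_matrix h (mat 1) = mat 1"
  by (simp add: vec_eq_iff mat_def ring_homomorphism_simps[OF assms])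

lemma matrix_2_eq_iff:
  "(A :: 'a^2^2) = B \<longleftrightarrow> A$1$1 = B$1$1 \<and> A$1$2 = B$1$2 \<and> A$2$1 = B$2$1 \<and> A$2$2 = B$2$2"
  by (auto simp: vec_eq_iff forall_2)

lemma matrix_mult_2:
  "((A :: 'a::semiring_1^2^2) ** B) $ i $ j = A$i$1 * B$1$j + A$i$2 * B$2$j"
  by (simp add: matrix_matrix_mult_def sum_2)

lemma conjugate_entry_polynomial:
  fixes T :: "complex \<Rightarrow> complex^'n^'n"
  assumes "\<And>i j. \<exists>p. \<forall>s. T s $ i $ j = poly p s"
  shows "\<exists>p. \<forall>s. (A ** T s ** B) $ i $ j = poly p s"
proof -
  obtain p where p: "\<And>i j s. T s $ i $ j = poly (p i j) s" using assms by metis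
  show ?thesis
    by (rule exI[of _ "\<Sum>k\<in>UNIV. (\<Sum>l\<in>UNIV. [:A $ i $ l:] * p l k) * [:B $ k $ j:]"])
       (simp add: matrix_matrix_mult_def p poly_sum mult.commute)
qed

section \<open>Fundamental matrices and the matrices of the automorphisms\<close>

context exponential_with_integral
begin

lemma ring_homomorphism_const: "ring_homomorphism (\<lambda>c. \<iota> (cst c))"
  using ring_homomorphism_simps[OF \<iota>] ring_homomorphism_simps[OF ring_homomorphism_cst]
  by (simp add: ring_homomorphism_def)

text \<open>Solutions of \<open>\<chi>' = 2 b \<chi>\<close> are constant multiples of one another,
  so a column operation clears one entry of the first row. The entry below it is \<open>e\<close>,
  and rescaling the other column makes its first entry \<open>e\<^sup>2\<close>.\<close>

lemma picard_vessiot_normal_form: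
  assumes PV: "picard_vessiot (vector [vector [2 * b, 0], vector [g, b]]) \<iota> d (\<Phi> :: 'l^2^2)"
  shows "\<exists>e v (B :: complex^2^2) B'. generating_pair e v \<and> B ** B' = mat 1 \<and> B' ** B = mat 1 \<and>
     \<Phi> = vector [vector [e\<^sup>2, 0], vector [e * v, e]] ** map_matrix (\<lambda>c. \<iota> (cst c)) B"
proof -
  note \<iota>s = ring_homomorphism_simps[OF \<iota>] and ds = derivation_simps[OF d]
  note \<kappa>s = ring_homomorphism_simps[OF ring_homomorphism_const]
  let ?\<kappa> = "\<lambda>c. \<iota> (cst c)"
  have \<kappa>_eq_0: "?\<kappa> c = 0 \<longleftrightarrow> c = 0" and \<kappa>_inverse: "?\<kappa> (inverse c) = inverse (?\<kappa> c)" for c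
    using ring_homomorphism_inverse[OF ring_homomorphism_const] by auto
  define p q r s where "p = \<Phi>$1$1" and "q = \<Phi>$1$2" and "r = \<Phi>$2$1" and "s = \<Phi>$2$2"
  note entries = p_def[symmetric] q_def[symmetric] r_def[symmetric] s_def[symmetric]
  have "map_matrix d \<Phi> = map_matrix \<iota> (vector [vector [2 * b, 0], vector [g, b]]) ** \<Phi>"
    using PV unfolding picard_vessiot_def by blast
  then have "map_matrix d \<Phi> $ i $ j
      = (map_matrix \<iota> (vector [vector [2 * b, 0], vector [g, b]]) ** \<Phi>) $ i $ j" for i j
    by (rule arg_cong)
  note this[unfolded nth_map_matrix matrix_mult_2]
  from this[of 1 1] this[of 1 2] this[of 2 1] this[of 2 2]
  have eqs: "d p = 2 * \<iota> b * p" "d q = 2 * \<iota> b * q"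
    "d r = \<iota> g * p + \<iota> b * r" "d s = \<iota> g * q + \<iota> b * s"
    unfolding entries vector_2 \<iota>s mult_2 by (simp_all add: distrib_right)
  have det: "p * s - q * r \<noteq> 0"
  proof -
    have "invertible \<Phi>" using PV unfolding picard_vessiot_def by blast
    then show ?thesis by (simp add: invertible_det_nz det_2 entries)
  qed
  have const: "\<exists>c. x = ?\<kappa> c" if "d x = 0" for x
    using PV that unfolding picard_vessiot_def by blast
  have gen: "S = UNIV" if "is_subfield S" "range \<iota> \<subseteq> S" "p \<in> S" "q \<in> S" "r \<in> S" "s \<in> S" for S
  proof -
    have "\<forall>i j. \<Phi> $ i $ j \<in> S" using that by (simp add: forall_2 entries)
    then show ?thesis using PV that(1,2) unfolding picard_vessiot_def by blast
  qed
  have quotient: "\<exists>c. x = ?\<kappa> c * y" if "d x = t * x" "d y = t * y" "y \<noteq> 0" for x y t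
  proof -
    have "x = (x / y) * y" using that(3) by simp
    then have "t * (x / y) * y = d (x / y) * y + (x / y) * (t * y)"
      using ds(2)[of "x / y" y] that by simp
    then have "d (x / y) * y = 0" by (simp add: algebra_simps)
    then have "d (x / y) = 0" using that(3) by simp
    then obtain c where "x / y = ?\<kappa> c" using const by blast
    then show ?thesis using that(3) by (metis nonzero_eq_divide_eq)
  qed
  have square: "d (e\<^sup>2) = 2 * \<iota> b * e\<^sup>2" if "d e = \<iota> b * e" for e
    by (simp add: power2_eq_square ds that algebra_simps)
  have pair: "generating_pair e v"
    if e: "d e = \<iota> b * e" "e \<noteq> 0" and w: "d (e * v) = \<iota> b * (e * v) + \<iota> g * e\<^sup>2"
      and S: "\<And>S. is_subfield S \<Longrightarrow> range \<iota> \<subseteq> S \<Longrightarrow> e \<in> S \<Longrightarrow> v \<in> S \<Longrightarrow> p \<in> S \<and> q \<in> S \<and> r \<in> S \<and> s \<in> S"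
    for e v
  proof -
    have "e * d v = e * (\<iota> g * e)"
      using w unfolding ds e(1) by (simp add: power2_eq_square algebra_simps)
    then have "d v = \<iota> g * e" using e(2) by simp
    then show ?thesis using e S gen unfolding generating_pair_def by blast
  qed
  have closed: "x * y \<in> S" "x + y \<in> S" if "is_subfield S" "x \<in> S" "y \<in> S" for S and x y :: 'l
  proof -
    have sub: "u - v \<in> S" "u * v \<in> S" if "u \<in> S" "v \<in> S" for u v
      using that \<open>is_subfield S\<close> unfolding is_subfield_def by blast+
    have "x - ((x - x) - y) \<in> S"
      by (intro sub that)
    then show "x + y \<in> S" by simp
    show "x * y \<in> S" by (intro sub that)
  qed
  show ?thesis
  proof (cases "p = 0")
    case False
    obtain k where k: "q = ?\<kappa> k * p" using quotient[OF eqs(2,1) False] by blast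
    \<comment> \<open>The second entry of column two minus \<open>k\<close> times column one; the
      first entry of that combination is zero, which removes the \<open>g\<close> term from its
      equation.\<close>
    define e where "e = s - ?\<kappa> k * r"
    have d\<kappa>: "d (?\<kappa> c) = 0" for c by (simp add: d\<iota> fract_pderiv_cst \<iota>s)
    have e: "d e = \<iota> b * e"
      unfolding e_def ds eqs d\<kappa> by (simp add: k algebra_simps)
    have "p * e \<noteq> 0" using det k by (simp add: e_def algebra_simps)
    then have "e \<noteq> 0" by simp
    obtain m where m: "e\<^sup>2 = ?\<kappa> m * p"
      using quotient[OF square[OF e] eqs(1) False] by blast
    then have "m \<noteq> 0" using \<open>e \<noteq> 0\<close> \<kappa>s(2) by auto
    define v where "v = ?\<kappa> m * r / e"
    have ev: "e * v = ?\<kappa> m * r" using \<open>e \<noteq> 0\<close> by (simp add: v_def)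
    \<comment> \<open>\<open>?B'\<close> performs the column operations that take
      \<open>\<Phi>\<close> to normal form, and \<open>?B\<close> undoes them.\<close>
    let ?B = "vector [vector [inverse m, k / m], vector [0, 1]] :: complex^2^2"
    let ?B' = "vector [vector [m, - k], vector [0, 1]] :: complex^2^2"
    have "?\<kappa> m \<noteq> 0" using \<open>m \<noteq> 0\<close> \<kappa>_eq_0 by blast
    then have sol: "p = ?\<kappa> (inverse m) * e\<^sup>2" "q = ?\<kappa> (k / m) * e\<^sup>2"
      "r = ?\<kappa> (inverse m) * (e * v)" "s = ?\<kappa> (k / m) * (e * v) + e"
      unfolding ev m divide_inverse \<kappa>s \<kappa>_inverse using k e_def by simp_all
    have "generating_pair e v"
    proof (rule pair[OF e \<open>e \<noteq> 0\<close>])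
      show "d (e * v) = \<iota> b * (e * v) + \<iota> g * e\<^sup>2"
        unfolding ev m ds eqs d\<kappa> by (simp add: algebra_simps)
      fix S assume S: "is_subfield S" "range \<iota> \<subseteq> S" "e \<in> S" "v \<in> S"
      then have "?\<kappa> c \<in> S" for c by blast
      then show "p \<in> S \<and> q \<in> S \<and> r \<in> S \<and> s \<in> S"
        unfolding sol power2_eq_square using S closed[OF S(1)] by simp
    qed
    moreover have "\<Phi> = vector [vector [e\<^sup>2, 0], vector [e * v, e]] ** map_matrix ?\<kappa> ?B"
      unfolding matrix_2_eq_iff by (simp add: matrix_mult_2 entries \<kappa>s) (simp add: sol mult.commute)
    moreover have "?B ** ?B' = mat 1" "?B' ** ?B = mat 1"
      unfolding matrix_2_eq_iff using \<open>m \<noteq> 0\<close> by (simp_all add: matrix_mult_2 mat_def divide_inverse)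
    ultimately show ?thesis by blast
  next
    case True
    \<comment> \<open>The first column already begins with zero, so \<open>r\<close> plays the role
      of \<open>e\<close>; the columns are swapped and the one containing \<open>q\<close> is scaled
      by \<open>m\<close>.\<close>
    have r: "d r = \<iota> b * r" using eqs(3) True by simp
    have "q \<noteq> 0" "r \<noteq> 0" using det True by auto
    obtain m where m: "r\<^sup>2 = ?\<kappa> m * q"
      using quotient[OF square[OF r] eqs(2) \<open>q \<noteq> 0\<close>] by blast
    then have "m \<noteq> 0" using \<open>r \<noteq> 0\<close> \<kappa>s(2) by auto
    define v where "v = ?\<kappa> m * s / r"
    have rv: "r * v = ?\<kappa> m * s" using \<open>r \<noteq> 0\<close> by (simp add: v_def)
    have d\<kappa>: "d (?\<kappa> c) = 0" for c by (simp add: d\<iota> fract_pderiv_cst \<iota>s)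
    let ?B = "vector [vector [0, inverse m], vector [1, 0]] :: complex^2^2"
    let ?B' = "vector [vector [0, 1], vector [m, 0]] :: complex^2^2"
    have "?\<kappa> m \<noteq> 0" using \<open>m \<noteq> 0\<close> \<kappa>_eq_0 by blast
    then have sol: "q = ?\<kappa> (inverse m) * r\<^sup>2" "s = ?\<kappa> (inverse m) * (r * v)"
      unfolding rv m \<kappa>s \<kappa>_inverse by simp_all
    have "generating_pair r v"
    proof (rule pair[OF r \<open>r \<noteq> 0\<close>])
      show "d (r * v) = \<iota> b * (r * v) + \<iota> g * r\<^sup>2"
        unfolding rv m ds eqs d\<kappa> by (simp add: algebra_simps)
      fix S assume S: "is_subfield S" "range \<iota> \<subseteq> S" "r \<in> S" "v \<in> S"
      then have \<kappa>S: "?\<kappa> c \<in> S" for c by blast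
      then have "p \<in> S" using True \<kappa>s(2) by metis
      with \<kappa>S show "p \<in> S \<and> q \<in> S \<and> r \<in> S \<and> s \<in> S"
        unfolding sol power2_eq_square using S closed[OF S(1)] by simp
    qed
    moreover have "\<Phi> = vector [vector [r\<^sup>2, 0], vector [r * v, r]] ** map_matrix ?\<kappa> ?B"
      unfolding matrix_2_eq_iff
      by (simp add: matrix_mult_2 entries \<kappa>s True) (simp add: sol mult.commute)
    moreover have "?B ** ?B' = mat 1" "?B' ** ?B = mat 1"
      unfolding matrix_2_eq_iff using \<open>m \<noteq> 0\<close> by (simp_all add: matrix_mult_2 mat_def)
    ultimately show ?thesis by blast
  qed
qed

text \<open>The automorphism scaling \<open>e\<close> by \<open>a\<close> and sending
  \<open>v\<close> to \<open>a v + c\<close> maps \<open>e v\<close> to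
  \<open>a\<^sup>2 e v + a c e\<close>, which gives the triangular matrix. Passing to
  \<open>\<Phi>\<close> conjugates it by \<open>B\<close>, whose entries are fixed.\<close>

lemma diff_galois_group_contains:
  fixes B B' :: "complex^2^2"
  assumes ev: "generating_pair e v" and B: "B ** B' = mat 1" and "a \<noteq> 0"
    and \<Phi>: "\<Phi> = vector [vector [e\<^sup>2, 0], vector [e * v, e]] ** map_matrix (\<lambda>c. \<iota> (cst c)) B"
  shows "B' ** vector [vector [a\<^sup>2, 0], vector [a * c, a]] ** B \<in> diff_galois_group \<iota> d (\<Phi> :: 'l^2^2)"
proof -
  let ?\<kappa> = "\<lambda>c. \<iota> (cst c)"
  let ?\<Psi> = "vector [vector [e\<^sup>2, 0], vector [e * v, e]] :: 'l^2^2"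
  let ?T = "vector [vector [a\<^sup>2, 0], vector [a * c, a]] :: complex^2^2"
  note \<kappa>s = ring_homomorphism_simps[OF ring_homomorphism_const]
  note \<kappa>m = map_matrix_mult[OF ring_homomorphism_const]
  obtain \<sigma> where \<sigma>: "\<sigma> \<in> diff_automorphisms \<iota> d"
    and e: "\<sigma> e = ?\<kappa> a * e" and v: "\<sigma> v = ?\<kappa> a * v + ?\<kappa> c"
    using affine_automorphism[OF ev \<open>a \<noteq> 0\<close>] by blast
  have hom: "ring_homomorphism \<sigma>" and fix_\<iota>: "\<sigma> (\<iota> x) = \<iota> x" for x
    using \<sigma> unfolding diff_automorphisms_def by auto
  note \<sigma>s = ring_homomorphism_simps[OF hom]
  have "map_matrix \<sigma> ?\<Psi> = ?\<Psi> ** map_matrix ?\<kappa> ?T"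
    unfolding matrix_2_eq_iff
    by (simp add: matrix_mult_2 \<sigma>s \<kappa>s e v power2_eq_square algebra_simps)
  moreover have "map_matrix \<sigma> (map_matrix ?\<kappa> B) = map_matrix ?\<kappa> B"
    by (simp add: vec_eq_iff fix_\<iota>)
  ultimately have "map_matrix \<sigma> \<Phi> = ?\<Psi> ** map_matrix ?\<kappa> ?T ** map_matrix ?\<kappa> B"
    unfolding \<Phi> map_matrix_mult[OF hom] by simp
  also have "\<dots> = ?\<Psi> ** map_matrix ?\<kappa> (B ** B') ** map_matrix ?\<kappa> ?T ** map_matrix ?\<kappa> B"
    by (simp add: B map_matrix_mat_1[OF ring_homomorphism_const])
  also have "\<dots> = \<Phi> ** map_matrix ?\<kappa> (B' ** ?T ** B)"
    unfolding \<Phi> \<kappa>m by (simp add: matrix_mul_assoc)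
  finally show ?thesis
    unfolding diff_galois_group_def using \<sigma> by blast
qed

lemma identity_component_not_commutative:
  assumes PV: "picard_vessiot (vector [vector [2 * b, 0], vector [g, b]]) \<iota> d (\<Phi> :: 'l^2^2)"
  shows "\<not> commutative (identity_component (diff_galois_group \<iota> d \<Phi>))"
proof
  assume comm: "commutative (identity_component (diff_galois_group \<iota> d \<Phi>))"
  define T :: "complex \<Rightarrow> complex \<Rightarrow> complex^2^2"
    where "T a c = vector [vector [a\<^sup>2, 0], vector [a * c, a]]" for a c
  obtain e v and B B' :: "complex^2^2" where ev: "generating_pair e v" and B: "B ** B' = mat 1" "B' ** B = mat 1"
    and \<Phi>: "\<Phi> = vector [vector [e\<^sup>2, 0], vector [e * v, e]] ** map_matrix (\<lambda>c. \<iota> (cst c)) B"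
    using picard_vessiot_normal_form[OF PV] by blast
  have mem: "B' ** T a c ** B \<in> diff_galois_group \<iota> d \<Phi>" if "a \<noteq> 0" for a c
    unfolding T_def by (rule diff_galois_group_contains[OF ev B(1) that \<Phi>])
  have "T 1 0 = mat 1"
    unfolding T_def matrix_2_eq_iff by (simp add: mat_def)
  then have one: "B' ** T 1 0 ** B = mat 1" by (simp add: B(2))
  \<comment> \<open>The diagonal curve reaches the identity at \<open>s = 1\<close>; the unipotent
    curve \<open>T 1 s\<close> treated next does so at \<open>s = 0\<close>.\<close>
  have "(\<lambda>s. B' ** T s 0 ** B) ` (- {0}) \<subseteq> identity_component (diff_galois_group \<iota> d \<Phi>)"
  proof (rule curve_in_identity_component)
    have "\<forall>i j. \<exists>p. \<forall>s. T s 0 $ i $ j = poly p s"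
      unfolding T_def forall_2
      by (auto intro: exI[of _ "[:0, 0, 1:]"] exI[of _ "[:0, 1:]"] exI[of _ 0] simp: power2_eq_square)
    then show "\<exists>p. \<forall>s. (B' ** T s 0 ** B) $ i $ j = poly p s" for i j
      by (intro conjugate_entry_polynomial) blast
    show "infinite (- {0 :: complex})"
      by (simp add: Compl_eq_Diff_UNIV infinite_UNIV_char_0)
    show "mat 1 \<in> (\<lambda>s. B' ** T s 0 ** B) ` (- {0})"
      using one by (intro image_eqI[of _ _ 1]) simp_all
  qed (use mem in auto)
  then have M: "B' ** T 2 0 ** B \<in> identity_component (diff_galois_group \<iota> d \<Phi>)" by auto
  have "(\<lambda>s. B' ** T 1 s ** B) ` UNIV \<subseteq> identity_component (diff_galois_group \<iota> d \<Phi>)"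
  proof (rule curve_in_identity_component)
    have "\<forall>i j. \<exists>p. \<forall>s. T 1 s $ i $ j = poly p s"
      unfolding T_def forall_2
      by (auto intro: exI[of _ "[:0, 1:]"] exI[of _ 0] exI[of _ 1])
    then show "\<exists>p. \<forall>s. (B' ** T 1 s ** B) $ i $ j = poly p s" for i j
      by (intro conjugate_entry_polynomial) blast
    show "infinite (UNIV :: complex set)" by (rule infinite_UNIV_char_0)
    show "mat 1 \<in> (\<lambda>s. B' ** T 1 s ** B) ` UNIV"
      using one by (intro image_eqI[of _ _ 0]) simp_all
  qed (use mem in auto)
  then have N: "B' ** T 1 1 ** B \<in> identity_component (diff_galois_group \<iota> d \<Phi>)" by auto
  have prod: "B ** ((B' ** S ** B) ** (B' ** S' ** B)) ** B' = S ** S'" for S S'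
  proof -
    have "B ** ((B' ** S ** B) ** (B' ** S' ** B)) ** B'
        = (B ** B') ** S ** (B ** B') ** S' ** (B ** B')"
      by (simp only: matrix_mul_assoc)
    then show ?thesis by (simp add: B)
  qed
  \<comment> \<open>Undoing the conjugation transfers commutation to \<open>T\<close>, but the lower
    left entries of these two products are \<open>2\<close> and \<open>4\<close>.\<close>
  have "T 2 0 ** T 1 1 = T 1 1 ** T 2 0"
    using comm M N prod unfolding commutative_def by metis
  then show False
    unfolding T_def matrix_2_eq_iff by (simp add: matrix_mult_2)
qed

end

theorem mainTheorem1:
  fixes F :: "complex poly poly" and f :: ratfun2
  assumes F: "F = cst2 (1/3) * X ^ 3 + cst2 (1/2) * X ^ 2 + (X + Y) ^ 2 * Y ^ 2 + cst2 (1/4) * Y ^ 4"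
    and f: "f = gradient_slope F"
  shows "f = to_fract (2 * (X + Y) * Y ^ 2 + 2 * (X + Y) ^ 2 * Y + Y ^ 3)
           / to_fract (X ^ 2 + X + 2 * (X + Y) * Y ^ 2)
      \<and> is_particular_solution f 0
      \<and> LVE2 f = vector [vector [2 * (2 * xK / (xK + 1)), 0],
                          vector [12 / (xK + 1),           2 * xK / (xK + 1)]]
      \<and> (\<forall>(\<iota> :: ratfun \<Rightarrow> 'l::field) (d :: 'l \<Rightarrow> 'l) (\<Phi> :: 'l^2^2).
           picard_vessiot (LVE2 f) \<iota> d \<Phi> \<longrightarrow>
           \<not> commutative (identity_component (diff_galois_group \<iota> d \<Phi>)))"
proof (intro conjI allI impI)
  have f': "f = to_fract [:0, [:0, 0, 2:], [:0, 6:], [:5:]:] / to_fract [:[:0, 1, 1:], 0, [:0, 2:], [:2:]:]"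
    unfolding f by (rule gradient_slope_of_potential(2)[OF F])
  show "f = to_fract (2 * (X + Y) * Y ^ 2 + 2 * (X + Y) ^ 2 * Y + Y ^ 3)
           / to_fract (X ^ 2 + X + 2 * (X + Y) * Y ^ 2)"
    unfolding f by (rule gradient_slope_of_potential(1)[OF F])
  show "is_particular_solution f 0"
    by (rule LVE2_coefficients(1)[OF f'])
  show LVE2: "LVE2 f = vector [vector [2 * (2 * xK / (xK + 1)), 0],
                          vector [12 / (xK + 1),           2 * xK / (xK + 1)]]"
    unfolding LVE2_def LVE2_coefficients(2,3)[OF f'] ..
  fix \<iota> :: "ratfun \<Rightarrow> 'l" and d :: "'l \<Rightarrow> 'l" and \<Phi> :: "'l^2^2"
  assume PV: "picard_vessiot (LVE2 f) \<iota> d \<Phi>"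
  \<comment> \<open>The Picard-Vessiot hypothesis supplies the differential field structure; the two
    lemmas on rational solutions supply \<open>no_exp\<close> and \<open>no_int\<close>.\<close>
  interpret exponential_with_integral \<iota> d "2 * xK / (xK + 1)" "12 / (xK + 1)"
  proof
    show "ring_homomorphism \<iota>" "derivation d" "d (\<iota> a) = \<iota> (fract_pderiv a)" for a
      using PV unfolding picard_vessiot_def by simp_all
  qed (use no_exponential_in_ratfun no_rational_solution in simp_all)
  show "\<not> commutative (identity_component (diff_galois_group \<iota> d \<Phi>))"
    by (rule identity_component_not_commutative[OF PV[unfolded LVE2]])
qed

end
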